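(* Let $G=(V,E)$ be a finite graph, $q\in\mathbb N$, $\beta\ge0$, let $P_{\rm SW}$ be the transition matrix of the Swendsen--Wang dynamics for the $q$-state Potts model on $G$ at inverse temperature $\beta$, let $w\in V$, and let $P_{\rm HB}^w$ be the heat-bath dynamics with the color of $w$ fixed to $1$ (defined below). Then \[ \lambda(P_{\rm SW})\;\ge\;\tilde c_{\rm SW}\,\lambda(P_{\rm HB}^w),\qquad \tilde c_{\rm SW}=\tilde c_{\rm SW}(G,\beta,q):=q^{-1}\bigl(q\,e^{2\beta}\bigr)^{-2\tilde\Delta}, \] where $\tilde\Delta=\max_{u\in V\setminus\{w\}}\deg_G(u)$.
   Context: Graphs are finite, parallel edges and loops allowed; $\deg_G(u)$ is the number of edges with endvertex $u$. Potts model: $\Omega_{\rm P}=\{1,\dots,q\}^V$, $E(\sigma)$ the set of edges whose endvertices have the same color in $\sigma$, $\pi(\sigma)=e^{\beta|E(\sigma)|}/Z$. For $A\subseteq E$, $c(A)$ is the number of connected components of $(V,A)$. Swendsen--Wang: with $p=1-e^{-\beta}$, $P_{\rm SW}(\sigma,\tau)=(1-p)^{|E(\sigma)|}\sum_{A\subseteq E(\sigma)\cap E(\tau)}\bigl(\tfrac{p}{1-p}\bigr)^{|A|}q^{-c(A)}$. Fixed-vertex model: $\Lambda_w=\{1,\dots,q\}^{V\setminus\{w\}}$; for $\bar\sigma\in\Lambda_w$ let $\bar\sigma^1\in\Omega_{\rm P}$ agree with $\bar\sigma$ on $V\setminus\{w\}$ and have $\bar\sigma^1(w)=1$; $\pi^w(\bar\sigma)=q\,\pi(\bar\sigma^1)$.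 For $v\in V\setminus\{w\}$ and $l\in\{1,\dots,q\}$, $\bar\sigma^{v,l}$ agrees with $\bar\sigma$ off $v$ and equals $l$ at $v$, and $\Omega^w_{\bar\sigma,v}=\{\bar\sigma^{v,l}:l=1,\dots,q\}$. Then $P^w_{\rm HB}(\bar\sigma,\bar\tau)=\frac{1}{|V|-1}\sum_{v\in V\setminus\{w\}}\frac{\pi^w(\bar\tau)}{\sum_{l=1}^q\pi^w(\bar\sigma^{v,l})}\mathbf 1(\bar\tau\in\Omega^w_{\bar\sigma,v})$, reversible w.r.t. $\pi^w$. Spectral gap: $\lambda(P)=1-\max\{|\xi|:\xi\text{ an eigenvalue of }P,\ \xi\neq1\}$. *)

theory Defs
  imports Complex_Main "HOL-Library.FuncSet"
begin

text \<open>Multigraph: finite vertex set V, finite edge index set E, each edge e has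
  endvertices endpts e (a pair; loops are pairs (a,a)).  Parallel edges are
  distinct edge indices with the same endpoints.\<close>

definition deg :: "'e set \<Rightarrow> ('e \<Rightarrow> 'v \<times> 'v) \<Rightarrow> 'v \<Rightarrow> nat" where
  "deg E endpts u = card {e \<in> E. fst (endpts e) = u \<or> snd (endpts e) = u}"

definition potts_states :: "'v set \<Rightarrow> nat \<Rightarrow> ('v \<Rightarrow> nat) set" where
  "potts_states V q = PiE V (\<lambda>_. {1..q})"

definition mono_edges :: "'e set \<Rightarrow> ('e \<Rightarrow> 'v \<times> 'v) \<Rightarrow> ('v \<Rightarrow> nat) \<Rightarrow> 'e set" where
  "mono_edges E endpts \<sigma> = {e \<in> E. \<sigma> (fst (endpts e)) = \<sigma> (snd (endpts e))}"

definition potts_Z :: "'v set \<Rightarrow> 'e set \<Rightarrow> ('e \<Rightarrow> 'v \<times> 'v) \<Rightarrow> nat \<Rightarrow> real \<Rightarrow> real" where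
  "potts_Z V E endpts q \<beta> = (\<Sum>\<sigma>\<in>potts_states V q. exp (\<beta> * card (mono_edges E endpts \<sigma>)))"

definition potts_pi :: "'v set \<Rightarrow> 'e set \<Rightarrow> ('e \<Rightarrow> 'v \<times> 'v) \<Rightarrow> nat \<Rightarrow> real \<Rightarrow> ('v \<Rightarrow> nat) \<Rightarrow> real" where
  "potts_pi V E endpts q \<beta> \<sigma> = exp (\<beta> * card (mono_edges E endpts \<sigma>)) / potts_Z V E endpts q \<beta>"

definition adj_rel :: "('e \<Rightarrow> 'v \<times> 'v) \<Rightarrow> 'e set \<Rightarrow> ('v \<times> 'v) set" where
  "adj_rel endpts A = {(a, b). \<exists>e\<in>A. endpts e = (a, b) \<or> endpts e = (b, a)}"

definition num_components :: "'v set \<Rightarrow> ('e \<Rightarrow> 'v \<times> 'v) \<Rightarrow> 'e set \<Rightarrow> nat" where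
  "num_components V endpts A = card (V // ((adj_rel endpts A)\<^sup>* \<inter> (V \<times> V)))"

definition P_SW :: "'v set \<Rightarrow> 'e set \<Rightarrow> ('e \<Rightarrow> 'v \<times> 'v) \<Rightarrow> nat \<Rightarrow> real
    \<Rightarrow> ('v \<Rightarrow> nat) \<Rightarrow> ('v \<Rightarrow> nat) \<Rightarrow> real" where
  "P_SW V E endpts q \<beta> \<sigma> \<tau> =
     (let p = 1 - exp (- \<beta>) in
      (1 - p) ^ card (mono_edges E endpts \<sigma>) *
      (\<Sum>A \<in> Pow (mono_edges E endpts \<sigma> \<inter> mono_edges E endpts \<tau>).
          (p / (1 - p)) ^ card A * (1 / real q ^ num_components V endpts A)))"

definition fixed_states :: "'v set \<Rightarrow> 'v \<Rightarrow> nat \<Rightarrow> ('v \<Rightarrow> nat) set" where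
  "fixed_states V w q = PiE (V - {w}) (\<lambda>_. {1..q})"

definition pi_w :: "'v set \<Rightarrow> 'e set \<Rightarrow> ('e \<Rightarrow> 'v \<times> 'v) \<Rightarrow> nat \<Rightarrow> real \<Rightarrow> 'v
    \<Rightarrow> ('v \<Rightarrow> nat) \<Rightarrow> real" where
  "pi_w V E endpts q \<beta> w \<sigma> = real q * potts_pi V E endpts q \<beta> (\<sigma>(w := 1))"

definition P_HB_w :: "'v set \<Rightarrow> 'e set \<Rightarrow> ('e \<Rightarrow> 'v \<times> 'v) \<Rightarrow> nat \<Rightarrow> real \<Rightarrow> 'v
    \<Rightarrow> ('v \<Rightarrow> nat) \<Rightarrow> ('v \<Rightarrow> nat) \<Rightarrow> real" where
  "P_HB_w V E endpts q \<beta> w \<sigma> \<tau> =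
     1 / (real (card V) - 1) *
     (\<Sum>v \<in> V - {w}.
        pi_w V E endpts q \<beta> w \<tau> / (\<Sum>l = 1..q. pi_w V E endpts q \<beta> w (\<sigma>(v := l))) *
        (if \<tau> \<in> {\<sigma>(v := l) | l. l \<in> {1..q}} then 1 else 0))"

definition is_eigenvalue :: "'s set \<Rightarrow> ('s \<Rightarrow> 's \<Rightarrow> real) \<Rightarrow> complex \<Rightarrow> bool" where
  "is_eigenvalue S P \<xi> \<longleftrightarrow> (\<exists>f :: 's \<Rightarrow> complex. (\<exists>x\<in>S. f x \<noteq> 0) \<and>
      (\<forall>x\<in>S. (\<Sum>y\<in>S. complex_of_real (P x y) * f y) = \<xi> * f x))"

text \<open>Spectral gap 1 - max{|xi| : xi eigenvalue, xi <> 1}; if there is no eigenvalue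
  other than 1, the maximum is taken to be 0 (gap 1).\<close>
definition spectral_gap :: "'s set \<Rightarrow> ('s \<Rightarrow> 's \<Rightarrow> real) \<Rightarrow> real" where
  "spectral_gap S P = 1 - Max ({0} \<union> {cmod \<xi> | \<xi>. is_eigenvalue S P \<xi> \<and> \<xi> \<noteq> 1})"

end

theory Submission
  imports Defs "HOL-Analysis.Function_Topology" "HOL-Combinatorics.Transposition"
    "Jordan_Normal_Form.Char_Poly"
begin

text \<open>The Swendsen--Wang kernel sees a state only through its monochromatic edges, so eigenfunctions
  for nonzero eigenvalues are invariant under permuting colours and live on the states with colour 1
  at \<open>w\<close>; there the kernel becomes a positive semidefinite reversible kernel \<open>R\<close>. Recolouring one
  vertex \<open>v \<noteq> w\<close> changes \<open>R\<close> by a factor at most \<open>C = (q e\<^sup>2\<^sup>\<beta>)\<^sup>\<Delta>\<close>, because deleting an edge creates at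
  most one new component. As the column sums of the heat-bath kernel \<open>P\<close> are at most \<open>q\<close>, this gives
  \<open>P R P \<le> q C\<^sup>2 R\<close> entrywise. Comparing Dirichlet forms and using that \<open>R\<close> is a contraction and
  \<open>P\<close> has norm at most \<open>1 - \<lambda>(P)\<close> on mean-zero functions yields the bound.\<close>

section \<open>Spectral gap\<close>

text \<open>Comparing \<open>P\<close> with \<open>R\<close> entry by entry would cost a factor
  governed by the whole graph, since one Swendsen--Wang step recolours all clusters at once and may
  give a prescribed state a tiny probability. In \<open>P R P\<close> the kernel \<open>R\<close>
  stands on both sides of the inequality, so only its change under one recolouring at each end
  matters; this is the origin of the square of \<open>C\<close>. Since \<open>w\<close> is never
  recoloured, its degree does not enter \<Delta>. The definition of the gap adds two obligations. It
  takes moduli, while a comparison of Dirichlet forms bounds eigenvalues only from above; positive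
  semidefiniteness of \<open>R\<close> takes care of the other side. It also discards the eigenvalue
  1 regardless of multiplicity, so the gap of \<open>P\<close> controls mean-zero functions only
  after irreducibility of \<open>P\<close> has shown that 1 does not occur among them.\<close>

lemma finite_eigenvalues:
  assumes "finite S"
  shows "finite {\<xi>. is_eigenvalue S P \<xi>}"
proof -
  \<comment> \<open>An enumeration of \<open>S\<close> turns the kernel into a matrix, so the
    eigenvalues are among the roots of a nonzero polynomial. Finiteness is what gives the
    \<open>Max\<close> in \<open>spectral_gap\<close> its meaning.\<close>
  obtain s n where s: "bij_betw s {0..<n::nat} S"
    using ex_bij_betw_nat_finite[OF assms] by blast
  define A where "A = mat n n (\<lambda>(i, j). complex_of_real (P (s i) (s j)))"
  have A: "A \<in> carrier_mat n n" by (simp add: A_def)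
  have "eigenvalue A \<xi>" if ev: "is_eigenvalue S P \<xi>" for \<xi>
  proof -
    from ev obtain f x where fx: "x \<in> S" "f x \<noteq> 0"
      and f: "\<And>x. x \<in> S \<Longrightarrow> (\<Sum>y\<in>S. complex_of_real (P x y) * f y) = \<xi> * f x"
      unfolding is_eigenvalue_def by blast
    define v where "v = vec n (f \<circ> s)"
    obtain i where i: "i < n" "s i = x"
      using fx s by (auto simp: bij_betw_def)
    have "v $ i \<noteq> 0\<^sub>v n $ i" using i fx by (simp add: v_def)
    hence "v \<noteq> 0\<^sub>v n" by auto
    moreover have "A *\<^sub>v v = \<xi> \<cdot>\<^sub>v v"
    proof (rule eq_vecI)
      fix k assume "k < dim_vec (\<xi> \<cdot>\<^sub>v v)"
      hence k: "k < n" by (simp add: v_def)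
      have "(A *\<^sub>v v) $ k = (\<Sum>j = 0..<n. complex_of_real (P (s k) (s j)) * f (s j))"
        using k by (simp add: A_def v_def scalar_prod_def)
      also have "\<dots> = (\<Sum>y\<in>S. complex_of_real (P (s k) y) * f y)"
        by (rule sum.reindex_bij_betw[OF s])
      also have "\<dots> = \<xi> * f (s k)"
        using k s by (intro f) (auto simp: bij_betw_def)
      finally show "(A *\<^sub>v v) $ k = (\<xi> \<cdot>\<^sub>v v) $ k" using k by (simp add: v_def)
    qed (simp add: A_def v_def)
    ultimately show ?thesis
      using A unfolding eigenvalue_def eigenvector_def by (intro exI[of _ v]) (simp add: v_def)
  qed
  hence "{\<xi>. is_eigenvalue S P \<xi>} \<subseteq> {\<xi>. poly (char_poly A) \<xi> = 0}"
    using eigenvalue_root_char_poly[OF A] by blast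
  moreover have "char_poly A \<noteq> 0"
    using degree_monic_char_poly[OF A] by auto
  ultimately show ?thesis
    using poly_roots_finite finite_subset by blast
qed

lemma finite_eigenvalue_moduli:
  assumes "finite S"
  shows "finite ({0} \<union> {cmod \<xi> | \<xi>. is_eigenvalue S P \<xi> \<and> \<xi> \<noteq> 1})"
proof -
  have "{cmod \<xi> | \<xi>. is_eigenvalue S P \<xi> \<and> \<xi> \<noteq> 1} \<subseteq> cmod ` {\<xi>. is_eigenvalue S P \<xi>}"
    by auto
  thus ?thesis using finite_eigenvalues[OF assms]
    by (meson finite.emptyI finite_Un finite_imageI finite_insert finite_subset)
qed

lemma spectral_gap_le_one:
  assumes "finite S"
  shows "spectral_gap S P \<le> 1"
  unfolding spectral_gap_def
  using Max_ge[OF finite_eigenvalue_moduli[OF assms], of 0] by simp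

lemma cmod_eigenvalue_le:
  assumes "finite S" "is_eigenvalue S P \<xi>" "\<xi> \<noteq> 1"
  shows "cmod \<xi> \<le> 1 - spectral_gap S P"
  unfolding spectral_gap_def
  using Max_ge[OF finite_eigenvalue_moduli[OF assms(1)], of "cmod \<xi>"] assms(2,3) by auto

text \<open>The set under \<open>Max\<close> always contains 0, which is why
  \<open>c \<le> 1\<close> accompanies the bounds on the eigenvalues.\<close>

lemma spectral_gap_geI:
  assumes "finite S" "c \<le> 1"
    and "\<And>\<xi>. is_eigenvalue S P \<xi> \<Longrightarrow> \<xi> \<noteq> 1 \<Longrightarrow> cmod \<xi> \<le> 1 - c"
  shows "c \<le> spectral_gap S P"
proof -
  have "Max ({0} \<union> {cmod \<xi> | \<xi>. is_eigenvalue S P \<xi> \<and> \<xi> \<noteq> 1}) \<le> 1 - c"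
    using finite_eigenvalue_moduli[OF assms(1)] assms(2,3) by (subst Max_le_iff) auto
  thus ?thesis by (simp add: spectral_gap_def)
qed

section \<open>Reversible kernels on a finite set\<close>

definition apply_kernel :: "'s set \<Rightarrow> ('s \<Rightarrow> 's \<Rightarrow> real) \<Rightarrow> ('s \<Rightarrow> real) \<Rightarrow> 's \<Rightarrow> real" where
  "apply_kernel S K f x = (\<Sum>y\<in>S. K x y * f y)"

definition weighted_inner :: "'s set \<Rightarrow> ('s \<Rightarrow> real) \<Rightarrow> ('s \<Rightarrow> real) \<Rightarrow> ('s \<Rightarrow> real) \<Rightarrow> real" where
  "weighted_inner S \<mu> f g = (\<Sum>x\<in>S. \<mu> x * f x * g x)"

locale reversible_kernel =
  fixes S :: "'s set" and \<mu> :: "'s \<Rightarrow> real" and K :: "'s \<Rightarrow> 's \<Rightarrow> real"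
  assumes finite_S [simp]: "finite S"
    and weight_pos: "x \<in> S \<Longrightarrow> \<mu> x > 0"
    and kernel_nonneg: "x \<in> S \<Longrightarrow> y \<in> S \<Longrightarrow> K x y \<ge> 0"
    and kernel_sum: "x \<in> S \<Longrightarrow> (\<Sum>y\<in>S. K x y) = 1"
    and detailed_balance: "x \<in> S \<Longrightarrow> y \<in> S \<Longrightarrow> \<mu> x * K x y = \<mu> y * K y x"
begin

abbreviation "op \<equiv> apply_kernel S K"
abbreviation "ip \<equiv> weighted_inner S \<mu>"

lemma ip_commute: "ip f g = ip g f"
  unfolding weighted_inner_def by (simp add: mult_ac)

lemma ip_cong: "(\<And>x. x \<in> S \<Longrightarrow> f x = f' x) \<Longrightarrow> (\<And>x. x \<in> S \<Longrightarrow> g x = g' x) \<Longrightarrow> ip f g = ip f' g'"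
  unfolding weighted_inner_def by simp

lemma ip_add_left: "ip (\<lambda>x. f x + g x) h = ip f h + ip g h"
  unfolding weighted_inner_def by (simp add: algebra_simps sum.distrib)

lemma ip_scale_left: "ip (\<lambda>x. c * f x) h = c * ip f h"
  unfolding weighted_inner_def by (simp add: sum_distrib_left mult_ac)

lemma ip_self_nonneg: "ip f f \<ge> 0"
  unfolding weighted_inner_def
  by (intro sum_nonneg) (simp add: weight_pos less_imp_le mult.assoc)

lemma ip_self_eq_0_iff: "ip f f = 0 \<longleftrightarrow> (\<forall>x\<in>S. f x = 0)"
proof -
  have "(\<Sum>x\<in>S. \<mu> x * f x * f x) = 0 \<longleftrightarrow> (\<forall>x\<in>S. \<mu> x * f x * f x = 0)"
    by (intro sum_nonneg_eq_0_iff) (simp_all add: weight_pos less_imp_le mult.assoc)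
  thus ?thesis unfolding weighted_inner_def using weight_pos by fastforce
qed

lemma op_add: "op (\<lambda>x. f x + g x) x = op f x + op g x"
  unfolding apply_kernel_def by (simp add: algebra_simps sum.distrib)

lemma op_scale: "op (\<lambda>x. c * f x) x = c * op f x"
  unfolding apply_kernel_def by (simp add: sum_distrib_left mult_ac)

lemma op_cong: "(\<And>x. x \<in> S \<Longrightarrow> f x = g x) \<Longrightarrow> op f x = op g x"
  unfolding apply_kernel_def by simp

lemma op_one: "x \<in> S \<Longrightarrow> op (\<lambda>_. c) x = c"
  unfolding apply_kernel_def using kernel_sum[of x] by (simp flip: sum_distrib_right)

lemma op_self_adjoint: "ip (op f) g = ip f (op g)"
proof -
  have "ip (op f) g = (\<Sum>x\<in>S. \<Sum>y\<in>S. (\<mu> x * K x y) * f y * g x)"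
    unfolding weighted_inner_def apply_kernel_def
    by (simp add: sum_distrib_left sum_distrib_right mult_ac)
  also have "\<dots> = (\<Sum>x\<in>S. \<Sum>y\<in>S. (\<mu> y * K y x) * f y * g x)"
    by (intro sum.cong) (simp_all add: detailed_balance)
  also have "\<dots> = (\<Sum>y\<in>S. \<Sum>x\<in>S. (\<mu> y * K y x) * f y * g x)"
    by (rule sum.swap)
  also have "\<dots> = ip f (op g)"
    unfolding weighted_inner_def apply_kernel_def
    by (simp add: sum_distrib_left sum_distrib_right mult_ac)
  finally show ?thesis .
qed

text \<open>Stationarity of \<mu>. It makes the operator preserve mean-zero functions and forces
  mean zero on eigenfunctions for eigenvalues other than 1.\<close>

lemma ip_op_one: "ip (op f) (\<lambda>_. 1) = ip f (\<lambda>_. 1)"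
  unfolding op_self_adjoint by (rule ip_cong) (simp_all add: op_one)

text \<open>Expand the square: row sums evaluate one square term, and detailed balance carries the
  other one to it. In this form the entries of \<open>K\<close> have nonnegative coefficients and
  the diagonal drops out, so an entrywise inequality between kernels passes to their forms.\<close>

lemma dirichlet_form:
  "ip f f - ip f (op f) = (\<Sum>x\<in>S. \<Sum>y\<in>S. \<mu> x * K x y * (f x - f y)\<^sup>2) / 2"
proof -
  have 1: "(\<Sum>x\<in>S. \<Sum>y\<in>S. \<mu> x * K x y * (f x)\<^sup>2) = ip f f"
    unfolding weighted_inner_def
    by (intro sum.cong refl) (simp add: kernel_sum power2_eq_square mult_ac flip: sum_distrib_left sum_distrib_right)
  have "(\<Sum>x\<in>S. \<Sum>y\<in>S. \<mu> x * K x y * (f y)\<^sup>2) = (\<Sum>x\<in>S. \<Sum>y\<in>S. \<mu> y * K y x * (f y)\<^sup>2)"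
    by (intro sum.cong) (simp_all add: detailed_balance)
  also have "\<dots> = (\<Sum>y\<in>S. \<Sum>x\<in>S. \<mu> y * K y x * (f y)\<^sup>2)"
    by (rule sum.swap)
  finally have 2: "(\<Sum>x\<in>S. \<Sum>y\<in>S. \<mu> x * K x y * (f y)\<^sup>2) = ip f f" using 1 by simp
  have 3: "(\<Sum>x\<in>S. \<Sum>y\<in>S. \<mu> x * K x y * (f x * f y)) = ip f (op f)"
    unfolding weighted_inner_def apply_kernel_def by (simp add: sum_distrib_left mult_ac)
  have "(\<Sum>x\<in>S. \<Sum>y\<in>S. \<mu> x * K x y * (f x - f y)\<^sup>2) =
      (\<Sum>x\<in>S. \<Sum>y\<in>S. \<mu> x * K x y * (f x)\<^sup>2) + (\<Sum>x\<in>S. \<Sum>y\<in>S. \<mu> x * K x y * (f y)\<^sup>2)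
      - 2 * (\<Sum>x\<in>S. \<Sum>y\<in>S. \<mu> x * K x y * (f x * f y))"
    by (simp add: sum_distrib_left power2_diff algebra_simps sum.distrib sum_subtractf)
  thus ?thesis using 1 2 3 by simp
qed

lemma ip_op_le: "ip f (op f) \<le> ip f f"
proof -
  have "(\<Sum>x\<in>S. \<Sum>y\<in>S. \<mu> x * K x y * (f x - f y)\<^sup>2) \<ge> 0"
    by (intro sum_nonneg mult_nonneg_nonneg) (simp_all add: weight_pos less_imp_le kernel_nonneg)
  thus ?thesis using dirichlet_form[of f] by simp
qed

text \<open>The Dirichlet form of a fixed point vanishes, hence so does each of its nonnegative
  terms.\<close>

lemma fixed_point_neighbours:
  assumes "\<And>x. x \<in> S \<Longrightarrow> op f x = f x" "x \<in> S" "y \<in> S" "K x y > 0"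
  shows "f x = f y"
proof -
  have "ip f (op f) = ip f f" by (rule ip_cong) (simp_all add: assms)
  hence "(\<Sum>x\<in>S. \<Sum>y\<in>S. \<mu> x * K x y * (f x - f y)\<^sup>2) = 0"
    using dirichlet_form[of f] by simp
  moreover have nn: "\<mu> x * K x y * (f x - f y)\<^sup>2 \<ge> 0" if "x \<in> S" "y \<in> S" for x y
    using that by (simp add: weight_pos less_imp_le kernel_nonneg)
  ultimately have "\<forall>x\<in>S. \<forall>y\<in>S. \<mu> x * K x y * (f x - f y)\<^sup>2 = 0"
    by (subst (asm) sum_nonneg_eq_0_iff; simp add: sum_nonneg sum_nonneg_eq_0_iff)
  thus ?thesis using assms(2-4) weight_pos[of x] by fastforce
qed

lemma is_eigenvalueI:
  assumes "\<And>x. x \<in> S \<Longrightarrow> op f x = \<eta> * f x" "x \<in> S" "f x \<noteq> 0"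
  shows "is_eigenvalue S K (of_real \<eta>)"
  unfolding is_eigenvalue_def
proof (intro exI[of _ "\<lambda>x. of_real (f x)"] conjI ballI bexI[of _ x])
  fix x assume "x \<in> S"
  hence "of_real (op f x) = complex_of_real (\<eta> * f x)" using assms(1) by simp
  thus "(\<Sum>y\<in>S. of_real (K x y) * complex_of_real (f y)) = of_real \<eta> * of_real (f x)"
    by (simp add: apply_kernel_def)
qed (use assms in auto)

section \<open>Operator norm on mean-zero functions\<close>

lemma compact_mean_zero_sphere:
  "compact {f. (\<forall>x. x \<notin> S \<longrightarrow> f x = 0) \<and> ip f (\<lambda>_. 1) = 0 \<and> ip f f = 1}" (is "compact ?D")
proof -
  have [continuous_intros]: "continuous_on UNIV (\<lambda>f. f x)" for x :: 's
    by (intro continuous_on_product_coordinates)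
  \<comment> \<open>\<open>ip f f = 1\<close> bounds each term
    \<open>\<mu> x * (f x)\<^sup>2\<close> by 1, whence the intervals. Outside \<open>S\<close> the
    factor is \<open>{0}\<close>, so the product over the whole type is compact by Tychonoff, and
    the sphere is a closed part of it.\<close>
  define K where "K = PiE UNIV (\<lambda>x. if x \<in> S then {- (1 / sqrt (\<mu> x)) .. 1 / sqrt (\<mu> x)} else {0 :: real})"
  have "compactin (product_topology (\<lambda>_. euclidean) UNIV) K"
    unfolding K_def by (subst compactin_PiE) auto
  hence "compact K" by (simp add: euclidean_product_topology)
  moreover have "closed {f. ip f (\<lambda>_. 1) = 0}" "closed {f. ip f f = 1}"
    unfolding weighted_inner_def by (intro closed_Collect_eq continuous_intros)+
  ultimately have "compact (K \<inter> {f. ip f (\<lambda>_. 1) = 0} \<inter> {f. ip f f = 1})"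
    using compact_Int_closed by blast
  moreover have K_zero: "f x = 0" if "f \<in> K" "x \<notin> S" for f x
    using PiE_mem[OF that(1)[unfolded K_def], of x] that(2) by simp
  moreover have "f \<in> K" if "\<forall>x. x \<notin> S \<longrightarrow> f x = 0" "ip f f = 1" for f
  proof -
    have "f x \<in> {- (1 / sqrt (\<mu> x)) .. 1 / sqrt (\<mu> x)}" if x: "x \<in> S" for x
    proof -
      have "\<mu> x * f x * f x \<le> ip f f" unfolding weighted_inner_def
        by (rule member_le_sum) (simp_all add: x weight_pos less_imp_le mult.assoc)
      hence "(f x)\<^sup>2 \<le> 1 / \<mu> x" using \<open>ip f f = 1\<close> weight_pos[OF x]
        by (simp add: field_simps power2_eq_square)
      hence "\<bar>f x\<bar> \<le> sqrt (1 / \<mu> x)" by (simp add: real_le_rsqrt)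
      thus ?thesis by (simp add: real_sqrt_divide abs_le_iff)
    qed
    thus ?thesis using that(1) unfolding K_def by auto
  qed
  hence "?D = K \<inter> {f. ip f (\<lambda>_. 1) = 0} \<inter> {f. ip f f = 1}"
    using K_zero by blast
  ultimately show ?thesis by simp
qed

text \<open>The maximum of the quadratic form of the squared operator on the unit sphere is attained at
  an eigenvector of the square, which splits into eigenvectors of the operator itself.\<close>

lemma norm_op_le:
  assumes eig: "\<And>\<eta> f. (\<And>x. x \<in> S \<Longrightarrow> op f x = \<eta> * f x) \<Longrightarrow> ip f (\<lambda>_. 1) = 0
      \<Longrightarrow> \<exists>x\<in>S. f x \<noteq> 0 \<Longrightarrow> \<bar>\<eta>\<bar> \<le> m"
    and "m \<ge> 0" and g: "ip g (\<lambda>_. 1) = 0"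
  shows "ip (op g) (op g) \<le> m\<^sup>2 * ip g g"
proof (cases "ip g g = 0")
  case True
  hence g0: "g x = 0" if "x \<in> S" for x using that by (simp add: ip_self_eq_0_iff)
  have "op g x = 0" for x
    unfolding apply_kernel_def by (intro sum.neutral) (simp add: g0)
  hence "ip (op g) (op g) = 0" by (simp add: ip_self_eq_0_iff)
  thus ?thesis using True by simp
next
  case False
  define D where "D = {f. (\<forall>x. x \<notin> S \<longrightarrow> f x = 0) \<and> ip f (\<lambda>_. 1) = 0 \<and> ip f f = 1}"
  define normalize where
    "normalize h = (\<lambda>x. 1 / sqrt (ip h h) * (if x \<in> S then h x else 0))" for h
  have normalize: "normalize h \<in> D"
    and normalize_op: "ip (op (normalize h)) (op (normalize h)) = ip (op h) (op h) / ip h h"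
    if h: "ip h (\<lambda>_. 1) = 0" "ip h h \<noteq> 0" for h
  proof -
    have hp: "ip h h > 0" using h(2) ip_self_nonneg[of h] by linarith
    have eq: "ip (normalize h) k = 1 / sqrt (ip h h) * ip h k" for k
    proof -
      have "ip (normalize h) k = ip (\<lambda>x. 1 / sqrt (ip h h) * h x) k"
        by (rule ip_cong) (simp_all add: normalize_def)
      thus ?thesis by (simp only: ip_scale_left)
    qed
    have "ip (normalize h) (normalize h) = 1"
      using hp by (simp add: eq ip_commute[of h "normalize h"] flip: real_sqrt_mult)
    thus "normalize h \<in> D" using h(1) unfolding D_def by (simp add: eq) (simp add: normalize_def)
    have "op (normalize h) x = 1 / sqrt (ip h h) * op h x" for x
    proof -
      have "op (normalize h) x = op (\<lambda>x. 1 / sqrt (ip h h) * h x) x"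
        by (rule op_cong) (simp add: normalize_def)
      thus ?thesis by (simp only: op_scale)
    qed
    hence op_n: "op (normalize h) = (\<lambda>x. 1 / sqrt (ip h h) * op h x)" by (rule ext)
    have "ip (op (normalize h)) k = 1 / sqrt (ip h h) * ip (op h) k" for k
      unfolding op_n by (rule ip_scale_left)
    hence "ip (op (normalize h)) (op (normalize h))
        = 1 / sqrt (ip h h) * (1 / sqrt (ip h h) * ip (op h) (op h))"
      by (simp only: ip_commute[of "op h" "op (normalize h)"])
    thus "ip (op (normalize h)) (op (normalize h)) = ip (op h) (op h) / ip h h"
      using hp by (simp flip: real_sqrt_mult)
  qed
  have "D \<noteq> {}" using normalize[OF g False] by blast
  moreover have "compact D" unfolding D_def by (rule compact_mean_zero_sphere)
  moreover have "continuous_on D (\<lambda>f. ip (op f) (op f))"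
    unfolding weighted_inner_def apply_kernel_def
    by (intro continuous_intros continuous_on_subset[OF continuous_on_product_coordinates]) auto
  ultimately obtain f where f: "f \<in> D"
    and f_max: "\<And>h. h \<in> D \<Longrightarrow> ip (op h) (op h) \<le> ip (op f) (op f)"
    using continuous_attains_sup[of D "\<lambda>f. ip (op f) (op f)"] by blast
  define M where "M = ip (op f) (op f)"
  have M: "ip (op h) (op h) \<le> M * ip h h" if h: "ip h (\<lambda>_. 1) = 0" for h
  proof (cases "ip h h = 0")
    case True
    hence "op h x = 0" for x
      unfolding apply_kernel_def by (intro sum.neutral) (simp add: ip_self_eq_0_iff)
    hence "ip (op h) (op h) = 0" by (simp add: ip_self_eq_0_iff)
    thus ?thesis using True by simp
  next
    case False
    hence "ip h h > 0" using ip_self_nonneg[of h] by linarith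
    thus ?thesis using f_max[OF normalize[OF h False]] normalize_op[OF h False]
      by (simp add: M_def field_simps)
  qed
  have f1: "ip f f = 1" "ip f (\<lambda>_. 1) = 0" using f by (auto simp: D_def)
  have "M \<ge> 0" unfolding M_def by (rule ip_self_nonneg)
  \<comment> \<open>The residual of the eigenvalue equation for the square. Testing the maximality
    of \<open>f\<close> in the direction \<open>r\<close> itself replaces Lagrange
    multipliers.\<close>
  define r where "r = (\<lambda>x. M * f x + (-1) * op (op f) x)"
  have r0: "ip r (\<lambda>_. 1) = 0"
    unfolding r_def by (simp only: ip_add_left ip_scale_left ip_op_one f1)
  have rr: "ip r r = M * ip f r - ip (op f) (op r)"
    by (subst (1) r_def) (simp only: ip_add_left ip_scale_left op_self_adjoint)
  \<comment> \<open>The left side is \<open>M\<close> times the squared norm of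
    \<open>f + t r\<close> minus the squared norm of its image. The constant terms cancel because
    \<open>ip f f = 1\<close>, and by \<open>rr\<close> the linear coefficient is
    \<open>2 * ip r r\<close>.\<close>
  have var: "2 * t * ip r r + t\<^sup>2 * (M * ip r r - ip (op r) (op r)) \<ge> 0" for t
  proof -
    define h where "h = (\<lambda>x. f x + t * r x)"
    have h0: "ip h (\<lambda>_. 1) = 0"
      unfolding h_def by (simp only: ip_add_left ip_scale_left f1 r0)
    have oph: "op h = (\<lambda>x. op f x + t * op r x)"
      unfolding h_def by (rule ext) (simp only: op_add op_scale)
    have "ip h k = ip f k + t * ip r k" for k
      unfolding h_def by (simp only: ip_add_left ip_scale_left)
    hence hh: "ip h h = 1 + 2 * t * ip f r + t\<^sup>2 * ip r r"
      using f1 by (simp add: ip_commute[of f h] ip_commute[of r h] ip_commute[of r f] power2_eq_square algebra_simps)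
    have "ip (op h) k = ip (op f) k + t * ip (op r) k" for k
      unfolding oph by (simp only: ip_add_left ip_scale_left)
    hence "ip (op h) (op h) = M + 2 * t * ip (op f) (op r) + t\<^sup>2 * ip (op r) (op r)"
      by (simp add: ip_commute[of "op f" "op h"] ip_commute[of "op r" "op h"] ip_commute[of "op r" "op f"] M_def power2_eq_square algebra_simps)
    moreover have "2 * t * ip r r = M * (2 * t * ip f r) - 2 * t * ip (op f) (op r)"
      by (subst rr) (simp add: algebra_simps)
    ultimately show ?thesis using M[OF h0] unfolding hh by (simp add: algebra_simps)
  qed
  have "ip r r = 0"
  proof (rule ccontr)
    assume "ip r r \<noteq> 0"
    hence pos: "ip r r > 0" using ip_self_nonneg[of r] by linarith
    define c where "c = M * ip r r - ip (op r) (op r)"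
    have "c \<ge> 0" using M[OF r0] by (simp add: c_def)
    \<comment> \<open>For a small negative \<open>t\<close> the linear term dominates; the 1 in the
      denominator covers \<open>c = 0\<close>.\<close>
    define t where "t = - ip r r / (c + 1)"
    have "t * (2 * ip r r + t * c) \<ge> 0"
      using var[of t] by (simp add: c_def power2_eq_square algebra_simps)
    moreover have "t < 0" using pos \<open>c \<ge> 0\<close> by (simp add: t_def divide_neg_pos)
    moreover have "2 * ip r r + t * c > 0"
    proof -
      have "- (t * c) \<le> ip r r" using pos \<open>c \<ge> 0\<close> by (simp add: t_def field_simps)
      thus ?thesis using pos by linarith
    qed
    ultimately show False using mult_neg_pos by fastforce
  qed
  hence f_eig: "op (op f) x = M * f x" if "x \<in> S" for x
    using that by (simp add: ip_self_eq_0_iff r_def)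
  \<comment> \<open>On \<open>S\<close> the product of \<open>op - sqrt M\<close> and
    \<open>op + sqrt M\<close> annihilates \<open>f\<close>. So either \<open>f\<close> is an
    eigenvector for \<open>- sqrt M\<close>, or its image under \<open>op + sqrt M\<close> is one
    for \<open>sqrt M\<close>.\<close>
  have "sqrt M \<le> m"
  proof (cases "\<forall>x\<in>S. op f x = - sqrt M * f x")
    case True
    moreover have "\<exists>x\<in>S. f x \<noteq> 0" using f1 ip_self_eq_0_iff[of f] by auto
    ultimately have "\<bar>- sqrt M\<bar> \<le> m" using f1(2) by (intro eig[of f]) auto
    thus ?thesis by simp
  next
    case False
    define h where "h = (\<lambda>x. op f x + sqrt M * f x)"
    have "\<exists>x\<in>S. h x \<noteq> 0" using False by (auto simp: h_def add_eq_0_iff2)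
    moreover have "ip h (\<lambda>_. 1) = 0"
      unfolding h_def by (simp only: ip_add_left ip_scale_left ip_op_one f1)
    moreover have "op h x = sqrt M * h x" if x: "x \<in> S" for x
    proof -
      have "op h x = M * f x + sqrt M * op f x"
        unfolding h_def by (simp only: op_add op_scale f_eig[OF x])
      thus ?thesis using \<open>M \<ge> 0\<close> by (simp add: h_def algebra_simps flip: real_sqrt_mult)
    qed
    ultimately have "\<bar>sqrt M\<bar> \<le> m" by (intro eig[of h]) auto
    thus ?thesis by simp
  qed
  hence "M \<le> m\<^sup>2" using \<open>M \<ge> 0\<close> by (simp add: real_sqrt_le_iff sqrt_le_D)
  thus ?thesis using M[OF g] ip_self_nonneg[of g] mult_right_mono order_trans by blast
qed

end

section \<open>Comparison of two reversible kernels\<close>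

locale two_reversible_kernels =
  P: reversible_kernel S \<mu> P + R: reversible_kernel S \<mu> R
  for S :: "'s set" and \<mu> P R
begin

text \<open>The kernel of \<open>P R P\<close>. Having \<open>P\<close> on both sides keeps it
  reversible, which \<open>P R\<close> need not be, and turns its quadratic form at \<open>g\<close>
  into that of \<open>R\<close> at \<open>P g\<close>.\<close>

definition sandwich :: "'s \<Rightarrow> 's \<Rightarrow> real" where
  "sandwich x y = (\<Sum>x'\<in>S. \<Sum>y'\<in>S. P x x' * R x' y' * P y' y)"

lemma apply_sandwich: "apply_kernel S sandwich f x = P.op (R.op (P.op f)) x"
proof -
  have "apply_kernel S sandwich f x
      = (\<Sum>y\<in>S. \<Sum>x'\<in>S. \<Sum>y'\<in>S. P x x' * (R x' y' * (P y' y * f y)))"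
    by (simp only: apply_kernel_def sandwich_def sum_distrib_right mult.assoc)
  also have "\<dots> = (\<Sum>x'\<in>S. \<Sum>y\<in>S. \<Sum>y'\<in>S. P x x' * (R x' y' * (P y' y * f y)))"
    by (rule sum.swap)
  also have "\<dots> = (\<Sum>x'\<in>S. \<Sum>y'\<in>S. \<Sum>y\<in>S. P x x' * (R x' y' * (P y' y * f y)))"
    by (intro sum.cong refl sum.swap)
  also have "\<dots> = P.op (R.op (P.op f)) x"
    unfolding apply_kernel_def by (simp add: sum_distrib_left)
  finally show ?thesis .
qed

sublocale Q: reversible_kernel S \<mu> sandwich
proof unfold_locales
  fix x y assume xy: "x \<in> S" "y \<in> S"
  show "sandwich x y \<ge> 0" unfolding sandwich_def
    using xy by (intro sum_nonneg mult_nonneg_nonneg P.kernel_nonneg R.kernel_nonneg) auto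
  \<comment> \<open>Three uses of detailed balance reverse the path
    \<open>x, x', y', y\<close>.\<close>
  have eq: "\<mu> x * (P x x' * R x' y' * P y' y) = \<mu> y * (P y y' * R y' x' * P x' x)"
    if "x' \<in> S" "y' \<in> S" for x' y'
  proof -
    have "\<mu> x * (P x x' * R x' y' * P y' y) = (\<mu> x * P x x') * R x' y' * P y' y" by simp
    also have "\<dots> = P x' x * (\<mu> x' * R x' y') * P y' y"
      using P.detailed_balance[of x x'] xy that by simp
    also have "\<dots> = P x' x * R y' x' * (\<mu> y' * P y' y)"
      using R.detailed_balance[of x' y'] that by simp
    finally show ?thesis using P.detailed_balance[of y' y] xy that by simp
  qed
  have "\<mu> x * sandwich x y = (\<Sum>x'\<in>S. \<Sum>y'\<in>S. \<mu> y * (P y y' * R y' x' * P x' x))"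
    unfolding sandwich_def sum_distrib_left by (intro sum.cong refl eq)
  also have "\<dots> = (\<Sum>y'\<in>S. \<Sum>x'\<in>S. \<mu> y * (P y y' * R y' x' * P x' x))"
    by (rule sum.swap)
  finally show "\<mu> x * sandwich x y = \<mu> y * sandwich y x"
    unfolding sandwich_def sum_distrib_left .
next
  fix x assume x: "x \<in> S"
  have "(\<Sum>y\<in>S. sandwich x y) = apply_kernel S sandwich (\<lambda>_. 1) x"
    by (simp add: apply_kernel_def)
  also have "\<dots> = P.op (R.op (P.op (\<lambda>_. 1))) x" by (rule apply_sandwich)
  also have "\<dots> = P.op (R.op (\<lambda>_. 1)) x"
    by (intro P.op_cong R.op_cong P.op_one)
  also have "\<dots> = P.op (\<lambda>_. 1) x" by (intro P.op_cong R.op_one)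
  also have "\<dots> = 1" using x by (rule P.op_one)
  finally show "(\<Sum>y\<in>S. sandwich x y) = 1" .
qed (auto simp: P.weight_pos)

lemma eigenvalue_comparison:
  assumes le: "\<And>x y. x \<in> S \<Longrightarrow> y \<in> S \<Longrightarrow> sandwich x y \<le> c * R x y" and "c > 0"
    and g: "\<And>x. x \<in> S \<Longrightarrow> R.op g x = \<xi> * g x" "\<xi> \<noteq> 1" "\<exists>x\<in>S. g x \<noteq> 0"
    and P: "\<And>\<eta> f. (\<And>x. x \<in> S \<Longrightarrow> P.op f x = \<eta> * f x) \<Longrightarrow> P.ip f (\<lambda>_. 1) = 0
      \<Longrightarrow> \<exists>x\<in>S. f x \<noteq> 0 \<Longrightarrow> \<bar>\<eta>\<bar> \<le> m" and "m \<ge> 0"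
  shows "1 - \<xi> \<ge> (1 - m) / c"
proof -
  have ip_Rg: "P.ip (R.op g) k = \<xi> * P.ip g k" for k
    using P.ip_cong[of "R.op g" "\<lambda>x. \<xi> * g x" k k] g(1) by (simp only: P.ip_scale_left)
  have g0: "P.ip g (\<lambda>_. 1) = 0" using R.ip_op_one[of g] ip_Rg g(2) by simp
  have "P.ip g g \<noteq> 0" using g(3) by (auto simp: P.ip_self_eq_0_iff)
  hence gg: "P.ip g g > 0" using P.ip_self_nonneg[of g] by linarith
  have E: "P.ip g g - P.ip g (R.op g) = (1 - \<xi>) * P.ip g g"
    using ip_Rg[of g] R.ip_commute[of g "R.op g"] by (simp add: algebra_simps)
  show ?thesis
  proof (cases "m \<le> 1")
    \<comment> \<open>For \<open>m > 1\<close> the lower bound is negative, and contraction of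
      \<open>R\<close> already gives \<open>\<xi> \<le> 1\<close>.\<close>
    case False
    have "(1 - \<xi>) * P.ip g g \<ge> 0" using E R.ip_op_le[of g] by simp
    hence "1 - \<xi> \<ge> 0" using gg by (simp add: zero_le_mult_iff)
    moreover have "(1 - m) / c \<le> 0" using False \<open>c > 0\<close> by (simp add: divide_nonpos_pos)
    ultimately show ?thesis by linarith
  next
    case True
    have "P.ip g (Q.op g) = P.ip g (P.op (R.op (P.op g)))"
      by (rule P.ip_cong) (simp_all add: apply_sandwich)
    also have "\<dots> = P.ip (P.op g) (R.op (P.op g))" by (simp add: P.op_self_adjoint)
    also have "\<dots> \<le> P.ip (P.op g) (P.op g)" by (rule R.ip_op_le)
    also have "\<dots> \<le> m\<^sup>2 * P.ip g g" by (rule P.norm_op_le[OF P \<open>m \<ge> 0\<close> g0])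
    \<comment> \<open>Passing from \<open>m\<^sup>2\<close> to \<open>m\<close> gives up a factor
      \<open>1 + m\<close>, so that the result is stated in the gap of \<open>P\<close>
      itself.\<close>
    also have "\<dots> \<le> m * P.ip g g"
      using gg True \<open>m \<ge> 0\<close> by (intro mult_right_mono) (auto simp: power2_eq_square mult_left_le)
    finally have "(1 - m) * P.ip g g \<le> P.ip g g - P.ip g (Q.op g)" by (simp add: algebra_simps)
    also have "\<dots> = (\<Sum>x\<in>S. \<Sum>y\<in>S. \<mu> x * sandwich x y * (g x - g y)\<^sup>2) / 2"
      by (rule Q.dirichlet_form)
    also have "\<dots> \<le> (\<Sum>x\<in>S. \<Sum>y\<in>S. c * (\<mu> x * R x y * (g x - g y)\<^sup>2)) / 2"
    proof (intro divide_right_mono sum_mono)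
      fix x y assume xy: "x \<in> S" "y \<in> S"
      have "\<mu> x * sandwich x y * (g x - g y)\<^sup>2 \<le> \<mu> x * (c * R x y) * (g x - g y)\<^sup>2"
        using xy by (intro mult_right_mono mult_left_mono le) (simp_all add: P.weight_pos less_imp_le)
      thus "\<mu> x * sandwich x y * (g x - g y)\<^sup>2 \<le> c * (\<mu> x * R x y * (g x - g y)\<^sup>2)"
        by (simp add: mult_ac)
    qed simp
    also have "\<dots> = c * (P.ip g g - P.ip g (R.op g))"
      unfolding R.dirichlet_form by (simp add: sum_distrib_left)
    also have "\<dots> = (c * (1 - \<xi>)) * P.ip g g" using E by simp
    finally have "1 - m \<le> c * (1 - \<xi>)" using gg by simp
    thus ?thesis using \<open>c > 0\<close> by (simp add: field_simps)
  qed
qed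

end

section \<open>Components and colourings\<close>

text \<open>Sending an \<open>r\<close>-class to the \<open>r'\<close>-class around it is injective
  away from the class of \<open>a\<close>: by \<open>split\<close>, when two distinct classes merge,
  one of them is the class of \<open>a\<close>.\<close>

lemma card_quotient_le_Suc:
  assumes equiv: "equiv V r" "equiv V r'" and "finite V" "r \<subseteq> r'"
    and split: "\<And>x y. (x, y) \<in> r' \<Longrightarrow> (x, y) \<in> r \<or> (x, a) \<in> r \<or> (y, a) \<in> r"
  shows "card (V // r) \<le> Suc (card (V // r'))"
proof -
  have fin: "finite (V // r)" "finite (V // r')"
    using \<open>finite V\<close> by (simp_all add: quotient_def)
  have r'r: "r' `` (r `` {x}) = r' `` {x}" if "x \<in> V" for x
  proof
    show "r' `` (r `` {x}) \<subseteq> r' `` {x}"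
      using \<open>r \<subseteq> r'\<close> equiv(2) by (auto elim: transD simp: equiv_def)
    show "r' `` {x} \<subseteq> r' `` (r `` {x})"
      using equiv_class_self[OF equiv(1) that] by blast
  qed
  have "inj_on (\<lambda>C. r' `` C) (V // r - {r `` {a}})"
  proof (rule inj_onI)
    fix C C' assume C: "C \<in> V // r - {r `` {a}}" "C' \<in> V // r - {r `` {a}}" "r' `` C = r' `` C'"
    obtain x y where xy: "x \<in> V" "y \<in> V" "C = r `` {x}" "C' = r `` {y}"
      using C by (auto elim!: quotientE)
    have "(x, y) \<in> r'"
      using C(3) xy by (simp add: r'r eq_equiv_class_iff[OF equiv(2)])
    moreover have "(x, a) \<notin> r" "(y, a) \<notin> r"
      using C(1,2) xy equiv_class_eq[OF equiv(1), of x a] equiv_class_eq[OF equiv(1), of y a]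
      by blast+
    ultimately have "(x, y) \<in> r" using split by blast
    thus "C = C'" using xy equiv_class_eq[OF equiv(1)] by blast
  qed
  moreover have "(\<lambda>C. r' `` C) ` (V // r - {r `` {a}}) \<subseteq> V // r'"
    by (auto elim!: quotientE simp: r'r intro: quotientI)
  ultimately have "card (V // r - {r `` {a}}) \<le> card (V // r')"
    by (rule card_inj_on_le) (rule fin)
  moreover have "card (V // r) \<le> Suc (card (V // r - {r `` {a}}))"
    using card_Suc_Diff1[OF fin(1), of "r `` {a}"] by (cases "r `` {a} \<in> V // r") auto
  ultimately show ?thesis by linarith
qed

lemma adj_rel_insert:
  "endpts e = (a, b) \<Longrightarrow> adj_rel endpts (insert e A) = insert (a, b) (insert (b, a) (adj_rel endpts A))"
  unfolding adj_rel_def by auto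

lemma sym_adj_rel_rtrancl: "sym ((adj_rel endpts A)\<^sup>*)"
  by (rule sym_rtrancl) (auto simp: sym_def adj_rel_def)

lemma adj_rel_mono: "A \<subseteq> B \<Longrightarrow> adj_rel endpts A \<subseteq> adj_rel endpts B"
  unfolding adj_rel_def by blast

lemma equiv_components: "equiv V ((adj_rel endpts A)\<^sup>* \<inter> V \<times> V)"
  using sym_adj_rel_rtrancl[of endpts A]
  by (intro equivI) (auto simp: refl_on_def sym_def trans_def intro: rtrancl_trans)

lemma num_components_insert_edge:
  assumes "finite V" "fst (endpts e) \<in> V" "snd (endpts e) \<in> V"
  shows "num_components V endpts A \<le> Suc (num_components V endpts (insert e A))"
proof -
  obtain a b where e: "endpts e = (a, b)" by fastforce
  have ab: "a \<in> V" using assms e by simp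
  let ?r = "(adj_rel endpts A)\<^sup>*" and ?r' = "(adj_rel endpts (insert e A))\<^sup>*"
  have split: "(x, y) \<in> ?r \<or> (x, a) \<in> ?r \<or> (y, a) \<in> ?r" if "(x, y) \<in> ?r'" for x y
  proof -
    have sym: "(u, v) \<in> ?r \<Longrightarrow> (v, u) \<in> ?r" for u v
      using sym_adj_rel_rtrancl[of endpts A] by (auto dest: symD)
    \<comment> \<open>A path that uses the new edge links each of its ends to \<open>a\<close> or
      \<open>b\<close> by old edges. If both ends reach \<open>b\<close>, they already reach each
      other; otherwise one of them reaches \<open>a\<close>.\<close>
    have "(x, y) \<in> ?r \<or> ((x, a) \<in> ?r \<or> (x, b) \<in> ?r) \<and> ((y, a) \<in> ?r \<or> (y, b) \<in> ?r)"
      using that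
    proof (induction rule: rtrancl_induct)
      case (step y z)
      from step.hyps(2) consider "(y, z) \<in> adj_rel endpts A" | "(y, z) = (a, b)" | "(y, z) = (b, a)"
        unfolding adj_rel_insert[of endpts, OF e] by blast
      thus ?case
      proof cases
        case 1
        hence "(y, z) \<in> ?r" "(z, y) \<in> ?r" using sym by auto
        thus ?thesis using step.IH by (meson rtrancl_trans)
      qed (use step.IH in auto)
    qed simp
    thus ?thesis using sym by (meson rtrancl_trans)
  qed
  have "?r \<subseteq> ?r'" by (intro rtrancl_mono adj_rel_mono) auto
  hence "card (V // (?r \<inter> V \<times> V)) \<le> Suc (card (V // (?r' \<inter> V \<times> V)))"
    using ab split
    by (intro card_quotient_le_Suc[OF equiv_components equiv_components \<open>finite V\<close>, of _ _ _ _ a]) auto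
  thus ?thesis by (simp add: num_components_def)
qed

text \<open>Invariant functions factor through the quotient; the value on a class is read off at a
  \<open>SOME\<close> representative.\<close>

lemma card_quotient_invariant_functions:
  assumes "equiv V r" "finite V"
  shows "card {\<tau> \<in> PiE V (\<lambda>_. {1..q}). \<forall>(x, y)\<in>r. \<tau> x = \<tau> y} = q ^ card (V // r)"
proof -
  have "bij_betw (\<lambda>g. \<lambda>x\<in>V. g (r `` {x})) (PiE (V // r) (\<lambda>_. {1..q}))
      {\<tau> \<in> PiE V (\<lambda>_. {1..q}). \<forall>(x, y)\<in>r. \<tau> x = \<tau> y}" (is "bij_betw ?F ?X ?Y")
  proof (rule bij_betwI[where g = "\<lambda>\<tau>. \<lambda>C\<in>V // r. \<tau> (SOME x. x \<in> C)"])
    show "?F \<in> ?X \<rightarrow> ?Y"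
    proof
      fix g assume g: "g \<in> ?X"
      have "?F g x = ?F g y" if "(x, y) \<in> r" for x y
        using that equiv_class_eq[OF assms(1) that] equiv_type[OF assms(1)] by auto
      thus "?F g \<in> ?Y" using g by (auto intro!: quotientI)
    qed
    have some: "(SOME y. y \<in> r `` {x}) \<in> V" "(x, SOME y. y \<in> r `` {x}) \<in> r" if "x \<in> V" for x
    proof -
      have "(SOME y. y \<in> r `` {x}) \<in> r `` {x}"
        using equiv_class_self[OF assms(1) that] by (rule someI)
      thus "(SOME y. y \<in> r `` {x}) \<in> V" "(x, SOME y. y \<in> r `` {x}) \<in> r"
        using equiv_type[OF assms(1)] by auto
    qed
    show "(\<lambda>\<tau>. \<lambda>C\<in>V // r. \<tau> (SOME x. x \<in> C)) \<in> ?Y \<rightarrow> ?X"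
    proof (rule Pi_I, rule restrict_PiE_iff[THEN iffD2], rule ballI)
      fix \<tau> C assume "\<tau> \<in> ?Y" "C \<in> V // r"
      thus "\<tau> (SOME x. x \<in> C) \<in> {1..q}"
        using some by (elim quotientE) auto
    qed
    show "(\<lambda>C\<in>V // r. ?F g (SOME x. x \<in> C)) = g" if "g \<in> ?X" for g
    proof (rule PiE_ext[OF _ that])
      show "(\<lambda>C\<in>V // r. ?F g (SOME x. x \<in> C)) \<in> ?X"
        using that some by (auto elim!: quotientE intro!: quotientI)
      fix C assume C: "C \<in> V // r"
      then obtain x where x: "x \<in> V" "C = r `` {x}" by (auto elim: quotientE)
      have "r `` {SOME y. y \<in> C} = C"
        unfolding x(2) by (rule equiv_class_eq[OF assms(1) some(2)[OF x(1)], symmetric])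
      thus "(\<lambda>C\<in>V // r. ?F g (SOME x. x \<in> C)) C = g C" using C some[OF x(1)] x(2) by simp
    qed
    show "?F (\<lambda>C\<in>V // r. \<tau> (SOME x. x \<in> C)) = \<tau>" if "\<tau> \<in> ?Y" for \<tau>
    proof
      fix x show "?F (\<lambda>C\<in>V // r. \<tau> (SOME x. x \<in> C)) x = \<tau> x"
      proof (cases "x \<in> V")
        case True
        hence "\<tau> x = \<tau> (SOME y. y \<in> r `` {x})" using that some(2) by blast
        thus ?thesis using True by (simp add: quotientI)
      next
        case False
        have "\<tau> \<in> PiE V (\<lambda>_. {1..q})" using that by blast
        from PiE_arb[OF this False] show ?thesis using False by simp
      qed
    qed
  qed
  hence "card ?Y = card ?X" by (rule bij_betw_same_card[symmetric])
  also have "\<dots> = q ^ card (V // r)"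
    using assms(2) by (subst card_PiE) (simp_all add: quotient_def)
  finally show ?thesis .
qed

lemma sum_Pow_insert:
  fixes F :: "'a set \<Rightarrow> 'b::comm_monoid_add"
  assumes "finite X" "e \<notin> X"
  shows "sum F (Pow (insert e X)) = (\<Sum>A\<in>Pow X. F A + F (insert e A))"
proof -
  have "sum F (Pow (insert e X)) = sum F (Pow X) + sum F (insert e ` Pow X)"
    unfolding Pow_insert using assms by (intro sum.union_disjoint) auto
  also have "sum F (insert e ` Pow X) = (\<Sum>A\<in>Pow X. F (insert e A))"
    using assms(2) by (subst sum.reindex) (auto intro!: inj_onI)
  finally show ?thesis by (simp add: sum.distrib)
qed

lemma sum_power_card_Pow:
  fixes x :: real
  assumes "finite X"
  shows "(\<Sum>A\<in>Pow X. x ^ card A) = (1 + x) ^ card X"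
  using prod_add[OF assms, of "\<lambda>_. x" "\<lambda>_. 1"] by (simp add: add.commute)

section \<open>Swendsen--Wang as a kernel on the fixed-vertex states\<close>

locale potts_model =
  fixes V :: "'v set" and E :: "'e set" and endpts :: "'e \<Rightarrow> 'v \<times> 'v"
    and q :: nat and \<beta> :: real and w :: 'v
  assumes finite_V [simp]: "finite V" and finite_E [simp]: "finite E"
    and endpts_in: "e \<in> E \<Longrightarrow> fst (endpts e) \<in> V \<and> snd (endpts e) \<in> V"
    and q_ge_1: "q \<ge> 1" and beta_nonneg: "\<beta> \<ge> 0"
    and w_in: "w \<in> V" and card_V: "card V \<ge> 2"
begin

abbreviation "mono_at \<equiv> mono_edges E endpts"
abbreviation "mono_fixed s \<equiv> mono_at (s(w := 1))"
abbreviation "\<Omega> \<equiv> potts_states V q"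
abbreviation "\<Lambda> \<equiv> fixed_states V w q"
abbreviation "\<mu> \<equiv> pi_w V E endpts q \<beta> w"
abbreviation "HB \<equiv> P_HB_w V E endpts q \<beta> w"

text \<open>With \<open>p = 1 - exp (- \<beta>)\<close> the ratio \<open>p / (1 - p)\<close> is
  \<open>exp \<beta> - 1\<close>. The power of \<open>q\<close> is negative, opposite to that of the
  random-cluster measure, because it is the probability of one particular colouring of the
  components.\<close>

definition fk_weight :: "'e set \<Rightarrow> real" where
  "fk_weight A = (exp \<beta> - 1) ^ card A * (1 / real q ^ num_components V endpts A)"

definition fk_sum :: "'e set \<Rightarrow> real" where
  "fk_sum B = (\<Sum>A\<in>Pow B. fk_weight A)"

text \<open>Each fixed-vertex state stands for \<open>q\<close> states with the same monochromatic
  edges, which the chain does not distinguish; the factor \<open>q\<close> collects their transition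
  probabilities.\<close>

definition SW_fixed :: "('v \<Rightarrow> nat) \<Rightarrow> ('v \<Rightarrow> nat) \<Rightarrow> real" where
  "SW_fixed s t = real q * P_SW V E endpts q \<beta> (s(w := 1)) (t(w := 1))"

lemma finite_states [simp]: "finite \<Omega>" "finite \<Lambda>"
  unfolding potts_states_def fixed_states_def by (auto intro!: finite_PiE)

lemma mono_subset: "mono_at \<sigma> \<subseteq> E"
  unfolding mono_edges_def by auto

lemma finite_mono [simp]: "finite (mono_at \<sigma>)"
  using mono_subset finite_E by (rule finite_subset)

lemma exp_beta_ge_1: "exp \<beta> \<ge> 1"
  using beta_nonneg by simp

lemma fk_weight_nonneg: "fk_weight A \<ge> 0"
  unfolding fk_weight_def using exp_beta_ge_1 by simp

lemma fk_sum_nonneg: "fk_sum B \<ge> 0"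
  unfolding fk_sum_def by (intro sum_nonneg fk_weight_nonneg)

lemma fk_sum_mono: "finite B \<Longrightarrow> A \<subseteq> B \<Longrightarrow> fk_sum A \<le> fk_sum B"
  unfolding fk_sum_def by (intro sum_mono2) (auto simp: fk_weight_nonneg)

lemma P_SW_eq:
  "P_SW V E endpts q \<beta> \<sigma> \<tau> = exp (- \<beta> * card (mono_at \<sigma>)) * fk_sum (mono_at \<sigma> \<inter> mono_at \<tau>)"
proof -
  have "(1 - exp (- \<beta>)) / exp (- \<beta>) = exp \<beta> - 1"
    by (simp add: exp_minus field_simps)
  moreover have "exp (- \<beta>) ^ card (mono_at \<sigma>) = exp (- \<beta> * card (mono_at \<sigma>))"
    by (simp add: mult.commute flip: exp_of_nat_mult)
  ultimately show ?thesis
    unfolding P_SW_def Let_def fk_sum_def fk_weight_def by simp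
qed

lemma SW_fixed_eq:
  "SW_fixed s t = real q * exp (- \<beta> * card (mono_fixed s)) * fk_sum (mono_fixed s \<inter> mono_fixed t)"
  by (simp add: SW_fixed_def P_SW_eq)

lemma card_compatible_colourings:
  assumes "A \<subseteq> E"
  shows "card {\<tau> \<in> \<Omega>. A \<subseteq> mono_at \<tau>} = q ^ num_components V endpts A"
proof -
  let ?r = "(adj_rel endpts A)\<^sup>* \<inter> V \<times> V"
  have "A \<subseteq> mono_at \<tau> \<longleftrightarrow> (\<forall>(x, y)\<in>?r. \<tau> x = \<tau> y)" for \<tau> :: "'v \<Rightarrow> nat"
  proof
    assume A: "A \<subseteq> mono_at \<tau>"
    have "\<tau> x = \<tau> y" if "(x, y) \<in> (adj_rel endpts A)\<^sup>*" for x y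
      using that
    proof (induction rule: rtrancl_induct)
      case (step y z)
      then obtain e where "e \<in> A" "endpts e = (y, z) \<or> endpts e = (z, y)"
        by (auto simp: adj_rel_def)
      hence "\<tau> y = \<tau> z" using A by (auto simp: mono_edges_def)
      thus ?case using step.IH by simp
    qed simp
    thus "\<forall>(x, y)\<in>?r. \<tau> x = \<tau> y" by auto
  next
    assume r: "\<forall>(x, y)\<in>?r. \<tau> x = \<tau> y"
    show "A \<subseteq> mono_at \<tau>"
    proof
      fix e assume "e \<in> A"
      moreover have "e \<in> E" using \<open>e \<in> A\<close> assms by blast
      moreover have "(fst (endpts e), snd (endpts e)) \<in> adj_rel endpts A"
        using \<open>e \<in> A\<close> unfolding adj_rel_def by auto
      ultimately have "(fst (endpts e), snd (endpts e)) \<in> ?r"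
        using endpts_in by blast
      thus "e \<in> mono_at \<tau>" using r \<open>e \<in> E\<close> by (auto simp: mono_edges_def)
    qed
  qed
  thus ?thesis
    using card_quotient_invariant_functions[OF equiv_components finite_V, of q endpts A]
    by (simp add: potts_states_def num_components_def)
qed

text \<open>After exchanging the sums, the number of colourings compatible with \<open>A\<close>
  cancels the power of \<open>q\<close> in \<open>fk_weight A\<close>. The remaining binomial sum
  cancels the prefactor.\<close>

lemma P_SW_sum: "(\<Sum>\<tau>\<in>\<Omega>. P_SW V E endpts q \<beta> \<sigma> \<tau>) = 1"
proof -
  have "(\<Sum>\<tau>\<in>\<Omega>. fk_sum (mono_at \<sigma> \<inter> mono_at \<tau>))
      = (\<Sum>\<tau>\<in>\<Omega>. \<Sum>A\<in>Pow (mono_at \<sigma>). if A \<subseteq> mono_at \<tau> then fk_weight A else 0)"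
    unfolding fk_sum_def by (intro sum.cong refl sum.mono_neutral_cong_left) auto
  also have "\<dots> = (\<Sum>A\<in>Pow (mono_at \<sigma>). \<Sum>\<tau>\<in>\<Omega>. if A \<subseteq> mono_at \<tau> then fk_weight A else 0)"
    by (rule sum.swap)
  also have "\<dots> = (\<Sum>A\<in>Pow (mono_at \<sigma>). (exp \<beta> - 1) ^ card A)"
  proof (rule sum.cong[OF refl])
    fix A assume "A \<in> Pow (mono_at \<sigma>)"
    hence A: "A \<subseteq> E" using mono_subset by blast
    have "(\<Sum>\<tau>\<in>\<Omega>. if A \<subseteq> mono_at \<tau> then fk_weight A else 0)
        = real (card {\<tau> \<in> \<Omega>. A \<subseteq> mono_at \<tau>}) * fk_weight A"
      by (simp flip: sum.inter_filter)
    thus "(\<Sum>\<tau>\<in>\<Omega>. if A \<subseteq> mono_at \<tau> then fk_weight A else 0) = (exp \<beta> - 1) ^ card A"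
      using q_ge_1 by (simp add: card_compatible_colourings[OF A] fk_weight_def)
  qed
  also have "\<dots> = exp (\<beta> * card (mono_at \<sigma>))"
    by (simp add: sum_power_card_Pow mult.commute flip: exp_of_nat_mult)
  finally show ?thesis
    by (simp add: P_SW_eq mult_exp_exp flip: sum_distrib_left)
qed

text \<open>Swapping the colours 1 and \<open>\<tau> w\<close> preserves monochromatic edges, so a function of these edges
  sums over all states to q times its sum over the states with colour 1 at w.\<close>

lemma sum_mono_invariant:
  fixes F :: "'e set \<Rightarrow> 'a::comm_semiring_1"
  shows "(\<Sum>\<tau>\<in>\<Omega>. F (mono_at \<tau>)) = of_nat q * (\<Sum>t\<in>\<Lambda>. F (mono_fixed t))"
    and "\<tau> \<in> \<Omega> \<Longrightarrow> \<exists>t\<in>\<Lambda>. mono_fixed t = mono_at \<tau>"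
proof -
  \<comment> \<open>\<open>fwd (c, t)\<close> swaps the colours 1 and \<open>c\<close>, which puts
    \<open>c\<close> at \<open>w\<close>; a transposition is its own inverse, so \<open>bwd\<close>
    applies the same one.\<close>
  define fwd :: "nat \<times> ('v \<Rightarrow> nat) \<Rightarrow> 'v \<Rightarrow> nat" where "fwd = (\<lambda>(c, t). \<lambda>x\<in>V. transpose 1 c ((t(w := 1)) x))"
  define bwd where "bwd \<tau> = (\<tau> w, \<lambda>x\<in>V - {w}. transpose 1 (\<tau> w) (\<tau> x))" for \<tau> :: "'v \<Rightarrow> nat"
  have tr: "transpose 1 c d \<in> {1..q}" if "c \<in> {1..q}" "d \<in> {1..q}" for c d :: nat
    using that q_ge_1 by (auto simp: transpose_def)
  have bwd_in: "bwd \<tau> \<in> {1..q} \<times> \<Lambda>" if "\<tau> \<in> \<Omega>" for \<tau>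
  proof -
    have "\<tau> x \<in> {1..q}" if "x \<in> V" for x
      using \<open>\<tau> \<in> \<Omega>\<close> that unfolding potts_states_def by (rule PiE_mem)
    thus ?thesis using tr w_in by (auto simp: bwd_def fixed_states_def simp del: atLeastAtMost_iff)
  qed
  have fwd_in: "fwd p \<in> \<Omega>" if p: "p \<in> {1..q} \<times> \<Lambda>" for p
  proof -
    obtain c t where ct: "p = (c, t)" by fastforce
    have "(t(w := 1)) x \<in> {1..q}" if "x \<in> V" for x
      using p that q_ge_1 PiE_mem[of t "V - {w}" "\<lambda>_. {1..q}" x] by (simp add: ct fixed_states_def)
    moreover have "c \<in> {1..q}" using p by (simp add: ct)
    ultimately show ?thesis
      using tr unfolding ct fwd_def potts_states_def prod.case restrict_PiE_iff by blast
  qed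
  have fwd_bwd: "fwd (bwd \<tau>) = \<tau>" if "\<tau> \<in> \<Omega>" for \<tau>
  proof
    fix x show "fwd (bwd \<tau>) x = \<tau> x"
      using that PiE_arb[of \<tau> V "\<lambda>_. {1..q}" x] by (auto simp: fwd_def bwd_def potts_states_def)
  qed
  have bwd_fwd: "bwd (fwd p) = p" if p: "p \<in> {1..q} \<times> \<Lambda>" for p
  proof -
    obtain c t where ct: "p = (c, t)" by fastforce
    have "t x = undefined" if "x \<notin> V - {w}" for x
      using p that PiE_arb[of t "V - {w}" "\<lambda>_. {1..q}" x] by (simp add: ct fixed_states_def)
    thus ?thesis using w_in by (auto simp: ct fwd_def bwd_def fun_eq_iff)
  qed
  have tr_eq: "transpose d c a = transpose d c b \<longleftrightarrow> a = b" for a b c d :: nat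
    by (metis transpose_involutory)
  have "mono_at (fwd (c, t)) = mono_fixed t" for c t
    unfolding mono_edges_def fwd_def prod.case
    by (intro Collect_cong conj_cong refl) (simp add: endpts_in tr_eq del: fun_upd_apply)
  hence mono_bwd: "mono_fixed (snd (bwd \<tau>)) = mono_at \<tau>" if "\<tau> \<in> \<Omega>" for \<tau>
    using fwd_bwd[OF that] by (metis prod.collapse)
  thus "\<tau> \<in> \<Omega> \<Longrightarrow> \<exists>t\<in>\<Lambda>. mono_fixed t = mono_at \<tau>"
    using bwd_in[of \<tau>] by (auto simp: mem_Times_iff)
  have "(\<Sum>\<tau>\<in>\<Omega>. F (mono_at \<tau>)) = (\<Sum>p\<in>{1..q} \<times> \<Lambda>. F (mono_fixed (snd p)))"
    by (rule sum.reindex_bij_witness[of _ fwd bwd]) (simp_all only: fwd_bwd bwd_fwd bwd_in fwd_in mono_bwd)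
  also have "\<dots> = (\<Sum>c\<in>{1..q}. \<Sum>t\<in>\<Lambda>. F (mono_fixed t))"
    unfolding sum.cartesian_product by (intro sum.cong refl) auto
  finally show "(\<Sum>\<tau>\<in>\<Omega>. F (mono_at \<tau>)) = of_nat q * (\<Sum>t\<in>\<Lambda>. F (mono_fixed t))"
    by simp
qed

section \<open>Sensitivity of the reduced kernel to recolouring one vertex\<close>

lemma fk_weight_insert_le:
  assumes "e \<in> E" "finite A" "e \<notin> A"
  shows "fk_weight (insert e A) \<le> (exp \<beta> - 1) * real q * fk_weight A"
proof -
  \<comment> \<open>An added edge merges at most two components, which costs at most one factor
    \<open>q\<close>.\<close>
  have "real q ^ num_components V endpts A \<le> real q ^ Suc (num_components V endpts (insert e A))"
    using q_ge_1 endpts_in[OF assms(1)] by (intro power_increasing num_components_insert_edge) auto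
  hence "1 / real q ^ num_components V endpts (insert e A)
      \<le> real q * (1 / real q ^ num_components V endpts A)"
    using q_ge_1 by (simp add: field_simps)
  hence "(exp \<beta> - 1) ^ card (insert e A) * (1 / real q ^ num_components V endpts (insert e A))
      \<le> (exp \<beta> - 1) ^ card (insert e A) * (real q * (1 / real q ^ num_components V endpts A))"
    using exp_beta_ge_1 by (intro mult_left_mono) auto
  thus ?thesis using assms(2,3) by (simp add: fk_weight_def mult_ac)
qed

text \<open>Pair each \<open>A\<close> avoiding \<open>e\<close> with \<open>insert e A\<close>. The
  constant comes from \<open>1 + (exp \<beta> - 1) * q \<le> q * exp \<beta>\<close>, which is
  \<open>q \<ge> 1\<close>.\<close>

lemma fk_sum_insert_le:
  assumes "e \<in> E" "finite X"
  shows "fk_sum (insert e X) \<le> real q * exp \<beta> * fk_sum X"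
proof (cases "e \<in> X")
  case True
  have "1 * 1 \<le> real q * exp \<beta>" using q_ge_1 exp_beta_ge_1 by (intro mult_mono) auto
  hence "1 * fk_sum X \<le> real q * exp \<beta> * fk_sum X"
    by (intro mult_right_mono fk_sum_nonneg) simp
  thus ?thesis using True by (simp add: insert_absorb)
next
  case False
  have "fk_sum (insert e X) = (\<Sum>A\<in>Pow X. fk_weight A + fk_weight (insert e A))"
    unfolding fk_sum_def using assms(2) False by (rule sum_Pow_insert)
  also have "\<dots> \<le> (\<Sum>A\<in>Pow X. real q * exp \<beta> * fk_weight A)"
  proof (rule sum_mono)
    fix A assume A: "A \<in> Pow X"
    hence "fk_weight (insert e A) \<le> (exp \<beta> - 1) * real q * fk_weight A"
      using assms False by (intro fk_weight_insert_le) (auto intro: finite_subset)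
    moreover have "1 * fk_weight A \<le> real q * fk_weight A"
      using q_ge_1 by (intro mult_right_mono fk_weight_nonneg) auto
    ultimately show "fk_weight A + fk_weight (insert e A) \<le> real q * exp \<beta> * fk_weight A"
      by (simp add: algebra_simps)
  qed
  finally show ?thesis by (simp add: fk_sum_def sum_distrib_left)
qed

lemma fk_sum_union_le:
  assumes "finite D" "D \<subseteq> E" "finite X"
  shows "fk_sum (X \<union> D) \<le> (real q * exp \<beta>) ^ card D * fk_sum X"
  using assms(1,2)
proof (induction D rule: finite_induct)
  case (insert e D)
  have "fk_sum (X \<union> insert e D) \<le> real q * exp \<beta> * fk_sum (X \<union> D)"
    using fk_sum_insert_le[of e "X \<union> D"] insert assms(3) by simp
  also have "\<dots> \<le> real q * exp \<beta> * ((real q * exp \<beta>) ^ card D * fk_sum X)"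
    using insert by (intro mult_left_mono) auto
  finally show ?case using insert by (simp add: mult_ac)
qed simp

definition \<Delta> :: nat where "\<Delta> = Max (deg E endpts ` (V - {w}))"

definition edges_at :: "'v \<Rightarrow> 'e set" where
  "edges_at v = {e \<in> E. fst (endpts e) = v \<or> snd (endpts e) = v}"

lemma card_edges_at_le: "v \<in> V - {w} \<Longrightarrow> card (edges_at v) \<le> \<Delta>"
  unfolding \<Delta>_def edges_at_def by (rule Max_ge) (auto simp: deg_def)

lemma mono_fixed_update: "v \<noteq> w \<Longrightarrow> mono_fixed (s(v := l)) \<subseteq> mono_fixed s \<union> edges_at v"
    "v \<noteq> w \<Longrightarrow> mono_fixed s \<subseteq> mono_fixed (s(v := l)) \<union> edges_at v"
  unfolding mono_edges_def edges_at_def by (auto split: if_splits)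

lemma q_exp_power_mono:
  "n \<le> m \<Longrightarrow> (real q * exp \<beta>) ^ n \<le> (real q * exp \<beta>) ^ m"
proof (rule power_increasing)
  have "1 * 1 \<le> real q * exp \<beta>" using q_ge_1 exp_beta_ge_1 by (intro mult_mono) auto
  thus "1 \<le> real q * exp \<beta>" by simp
qed

lemma fk_sum_edges_at_le:
  assumes "X \<subseteq> X' \<union> edges_at v" "v \<in> V - {w}" "finite X'"
  shows "fk_sum X \<le> (real q * exp \<beta>) ^ \<Delta> * fk_sum X'"
proof -
  have fin: "finite (edges_at v)" "edges_at v \<subseteq> E" unfolding edges_at_def by auto
  have "fk_sum X \<le> fk_sum (X' \<union> edges_at v)"
    using assms fin by (intro fk_sum_mono) auto
  also have "\<dots> \<le> (real q * exp \<beta>) ^ card (edges_at v) * fk_sum X'"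
    using fin assms(3) by (rule fk_sum_union_le)
  also have "\<dots> \<le> (real q * exp \<beta>) ^ \<Delta> * fk_sum X'"
    by (intro mult_right_mono q_exp_power_mono card_edges_at_le assms fk_sum_nonneg)
  finally show ?thesis .
qed

text \<open>Each edge at the recoloured vertex may contribute \<open>q * exp \<beta>\<close> through
  the sum over edge sets and another \<open>exp \<beta>\<close> through the prefactor, which depends
  on the number of monochromatic edges of the left state.\<close>

definition C :: real where "C = (real q * exp (2 * \<beta>)) ^ \<Delta>"

lemma C_pos: "C > 0" unfolding C_def using q_ge_1 by simp

lemma C_eq: "C = (real q * exp \<beta>) ^ \<Delta> * exp (\<beta> * \<Delta>)"
proof -
  have "exp (2 * \<beta>) = exp \<beta> * exp \<beta>" by (simp add: mult_exp_exp)
  thus ?thesis by (simp add: C_def power_mult_distrib mult.commute[of \<beta>] exp_of_nat_mult)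
qed

lemma SW_fixed_update_left:
  assumes "v \<in> V - {w}"
  shows "SW_fixed (s(v := l)) t \<le> C * SW_fixed s t"
proof -
  let ?s = "s(v := l)"
  have "card (mono_fixed s) \<le> card (mono_fixed ?s \<union> edges_at v)"
    using assms mono_fixed_update(2)[of v s l]
    by (intro card_mono) (auto simp: edges_at_def)
  also have "\<dots> \<le> card (mono_fixed ?s) + card (edges_at v)" by (rule card_Un_le)
  also have "\<dots> \<le> card (mono_fixed ?s) + \<Delta>" using card_edges_at_le[OF assms] by simp
  finally have "real (card (mono_fixed s)) \<le> real (card (mono_fixed ?s)) + real \<Delta>" by linarith
  hence "\<beta> * card (mono_fixed s) \<le> \<beta> * (card (mono_fixed ?s) + real \<Delta>)"
    using beta_nonneg by (rule mult_left_mono)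
  hence "exp (- \<beta> * card (mono_fixed ?s)) \<le> exp (\<beta> * \<Delta>) * exp (- \<beta> * card (mono_fixed s))"
    by (simp add: mult_exp_exp algebra_simps)
  moreover have "fk_sum (mono_fixed ?s \<inter> mono_fixed t)
      \<le> (real q * exp \<beta>) ^ \<Delta> * fk_sum (mono_fixed s \<inter> mono_fixed t)"
    using assms mono_fixed_update(1)[of v s l] by (intro fk_sum_edges_at_le[of _ _ v]) auto
  ultimately have "exp (- \<beta> * card (mono_fixed ?s)) * fk_sum (mono_fixed ?s \<inter> mono_fixed t)
      \<le> (exp (\<beta> * \<Delta>) * exp (- \<beta> * card (mono_fixed s)))
         * ((real q * exp \<beta>) ^ \<Delta> * fk_sum (mono_fixed s \<inter> mono_fixed t))"
    by (intro mult_mono fk_sum_nonneg) auto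
  hence "real q * (exp (- \<beta> * card (mono_fixed ?s)) * fk_sum (mono_fixed ?s \<inter> mono_fixed t))
      \<le> real q * ((exp (\<beta> * \<Delta>) * exp (- \<beta> * card (mono_fixed s)))
         * ((real q * exp \<beta>) ^ \<Delta> * fk_sum (mono_fixed s \<inter> mono_fixed t)))"
    by (rule mult_left_mono) simp
  thus ?thesis by (simp add: SW_fixed_eq C_eq mult_ac)
qed

text \<open>Here the prefactor is unchanged and only the sum over edge sets varies. The inequality
  runs from \<open>t\<close> to its recolouring because in \<open>sandwich\<close> the last
  heat-bath step leads into the right end.\<close>

lemma SW_fixed_update_right:
  assumes "v \<in> V - {w}"
  shows "SW_fixed s t \<le> C * SW_fixed s (t(v := l))"
proof -
  have "fk_sum (mono_fixed s \<inter> mono_fixed t)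
      \<le> (real q * exp \<beta>) ^ \<Delta> * fk_sum (mono_fixed s \<inter> mono_fixed (t(v := l)))"
    using assms mono_fixed_update(2)[of v t l] by (intro fk_sum_edges_at_le[of _ _ v]) auto
  also have "\<dots> \<le> C * fk_sum (mono_fixed s \<inter> mono_fixed (t(v := l)))"
  proof (intro mult_right_mono fk_sum_nonneg)
    have "(real q * exp \<beta>) ^ \<Delta> * 1 \<le> (real q * exp \<beta>) ^ \<Delta> * exp (\<beta> * \<Delta>)"
      using beta_nonneg by (intro mult_left_mono) auto
    thus "(real q * exp \<beta>) ^ \<Delta> \<le> C" by (simp add: C_eq)
  qed
  finally have "real q * exp (- \<beta> * card (mono_fixed s)) * fk_sum (mono_fixed s \<inter> mono_fixed t)
     \<le> real q * exp (- \<beta> * card (mono_fixed s)) * (C * fk_sum (mono_fixed s \<inter> mono_fixed (t(v := l))))"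
    by (intro mult_left_mono) auto
  thus ?thesis by (simp add: SW_fixed_eq mult_ac)
qed

section \<open>Reversibility of the reduced kernel\<close>

lemma potts_Z_pos: "potts_Z V E endpts q \<beta> > 0"
proof -
  have "(\<lambda>x\<in>V. 1) \<in> \<Omega>" using q_ge_1 by (auto simp: potts_states_def)
  thus ?thesis unfolding potts_Z_def by (intro sum_pos) auto
qed

lemma mu_eq: "\<mu> s = real q / potts_Z V E endpts q \<beta> * exp (\<beta> * card (mono_fixed s))"
  by (simp add: pi_w_def potts_pi_def)

lemma mu_pos: "\<mu> s > 0"
  unfolding mu_eq using potts_Z_pos q_ge_1 by simp

sublocale SW: reversible_kernel \<Lambda> \<mu> SW_fixed
proof unfold_locales
  fix s t
  show "SW_fixed s t \<ge> 0"
    unfolding SW_fixed_eq by (intro mult_nonneg_nonneg fk_sum_nonneg) auto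
  \<comment> \<open>The Gibbs factor in \<mu> cancels the prefactor of \<open>SW_fixed\<close>,
    leaving an expression symmetric in the two states.\<close>
  have "exp (\<beta> * card (mono_fixed u)) * exp (- \<beta> * card (mono_fixed u)) = 1" for u
    by (simp add: mult_exp_exp)
  hence "\<mu> u * SW_fixed u u' = (real q)\<^sup>2 / potts_Z V E endpts q \<beta> * fk_sum (mono_fixed u \<inter> mono_fixed u')" for u u'
    by (simp add: SW_fixed_eq mu_eq power2_eq_square)
  thus "\<mu> s * SW_fixed s t = \<mu> t * SW_fixed t s" by (simp add: Int_commute)
  have "(\<Sum>t\<in>\<Lambda>. SW_fixed s t) = (\<Sum>\<tau>\<in>\<Omega>. P_SW V E endpts q \<beta> (s(w := 1)) \<tau>)"
    unfolding SW_fixed_def P_SW_eq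
    by (subst sum_mono_invariant(1)[of "\<lambda>B. exp (- \<beta> * card (mono_fixed s)) * fk_sum (mono_fixed s \<inter> B)"])
      (simp add: sum_distrib_left)
  thus "(\<Sum>t\<in>\<Lambda>. SW_fixed s t) = 1" by (simp add: P_SW_sum)
qed (auto simp: mu_pos)

section \<open>Heat-bath dynamics\<close>

definition updates :: "'v \<Rightarrow> ('v \<Rightarrow> nat) \<Rightarrow> ('v \<Rightarrow> nat) set" where
  "updates v s = {s(v := l) | l. l \<in> {1..q}}"

definition local_weight :: "'v \<Rightarrow> ('v \<Rightarrow> nat) \<Rightarrow> real" where
  "local_weight v s = (\<Sum>l = 1..q. \<mu> (s(v := l)))"

lemma local_weight_pos: "local_weight v s > 0"
  unfolding local_weight_def using q_ge_1 by (intro sum_pos mu_pos) auto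

lemma local_weight_updates: "t \<in> updates v s \<Longrightarrow> local_weight v t = local_weight v s"
  unfolding updates_def local_weight_def by auto

lemma fixed_state_range: "s \<in> \<Lambda> \<Longrightarrow> v \<in> V - {w} \<Longrightarrow> s v \<in> {1..q}"
  unfolding fixed_states_def by (rule PiE_mem)

lemma updates_subset: "s \<in> \<Lambda> \<Longrightarrow> v \<in> V - {w} \<Longrightarrow> updates v s \<subseteq> \<Lambda>"
  unfolding updates_def fixed_states_def by (auto simp: PiE_iff extensional_def split: if_splits)

lemma updates_sym:
  assumes "s \<in> \<Lambda>" "v \<in> V - {w}" "t \<in> updates v s"
  shows "s \<in> updates v t"
proof -
  obtain l where "t = s(v := l)" using assms(3) by (auto simp: updates_def)
  hence "s = t(v := s v)" by simp
  thus ?thesis using fixed_state_range[OF assms(1,2)] unfolding updates_def by blast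
qed

lemma updates_sym_iff: "s \<in> \<Lambda> \<Longrightarrow> t \<in> \<Lambda> \<Longrightarrow> v \<in> V - {w} \<Longrightarrow> s \<in> updates v t \<longleftrightarrow> t \<in> updates v s"
  using updates_sym by blast

lemma sum_updates:
  fixes h :: "('v \<Rightarrow> nat) \<Rightarrow> real"
  assumes "s \<in> \<Lambda>" "v \<in> V - {w}"
  shows "(\<Sum>t\<in>\<Lambda>. h t * (if t \<in> updates v s then 1 else 0)) = (\<Sum>l = 1..q. h (s(v := l)))"
proof -
  have "(\<Sum>t\<in>\<Lambda>. h t * (if t \<in> updates v s then 1 else 0)) = (\<Sum>t\<in>\<Lambda> \<inter> updates v s. h t)"
    by (subst sum.inter_restrict) (auto intro: sum.cong)
  also have "\<Lambda> \<inter> updates v s = (\<lambda>l. s(v := l)) ` {1..q}"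
    using updates_subset[OF assms] unfolding updates_def by blast
  also have "sum h \<dots> = (\<Sum>l = 1..q. h (s(v := l)))"
    by (subst sum.reindex) (auto intro!: inj_onI dest: fun_upd_eqD)
  finally show ?thesis .
qed

lemma HB_eq:
  "HB s t = 1 / (real (card V) - 1) *
     (\<Sum>v\<in>V - {w}. \<mu> t / local_weight v s * (if t \<in> updates v s then 1 else 0))"
  unfolding P_HB_w_def local_weight_def updates_def ..

lemma card_V_minus: "real (card (V - {w})) = real (card V) - 1"
  using w_in card_V by (simp add: of_nat_diff)

lemma card_V_gt_1: "real (card V) - 1 > 0"
  using card_V by linarith

lemma HB_posD:
  assumes "HB s t \<noteq> 0"
  obtains v l where "v \<in> V - {w}" "t = s(v := l)"
proof -
  have "\<exists>v\<in>V - {w}. t \<in> updates v s"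
  proof (rule ccontr)
    assume "\<not> ?thesis"
    hence "HB s t = 0" unfolding HB_eq by (simp add: sum.neutral)
    thus False using assms by simp
  qed
  thus thesis using that unfolding updates_def by blast
qed

lemma HB_pos:
  assumes "v \<in> V - {w}" "t \<in> updates v s"
  shows "HB s t > 0"
  unfolding HB_eq using assms card_V_gt_1
  by (intro mult_pos_pos sum_pos2[of _ v]) (auto simp: mu_pos local_weight_pos less_imp_le)

sublocale HB: reversible_kernel \<Lambda> \<mu> HB
proof unfold_locales
  fix s t assume st: "s \<in> \<Lambda>" "t \<in> \<Lambda>"
  show "HB s t \<ge> 0" unfolding HB_eq using card_V_gt_1
    by (intro mult_nonneg_nonneg sum_nonneg) (auto simp: mu_pos local_weight_pos less_imp_le)
  have "\<mu> s * (\<mu> t / local_weight v s * (if t \<in> updates v s then 1 else 0))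
      = \<mu> t * (\<mu> s / local_weight v t * (if s \<in> updates v t then 1 else 0))" if "v \<in> V - {w}" for v
    using updates_sym_iff[OF st that] by (auto simp: local_weight_updates)
  hence "(\<Sum>v\<in>V - {w}. \<mu> s * (\<mu> t / local_weight v s * (if t \<in> updates v s then 1 else 0)))
      = (\<Sum>v\<in>V - {w}. \<mu> t * (\<mu> s / local_weight v t * (if s \<in> updates v t then 1 else 0)))"
    by (rule sum.cong[OF refl])
  thus "\<mu> s * HB s t = \<mu> t * HB t s"
    unfolding HB_eq by (simp only: sum_distrib_left[symmetric] mult.left_commute)
next
  fix s assume s: "s \<in> \<Lambda>"
  have "(\<Sum>t\<in>\<Lambda>. HB s t) = 1 / (real (card V) - 1) *
     (\<Sum>v\<in>V - {w}. \<Sum>t\<in>\<Lambda>. \<mu> t / local_weight v s * (if t \<in> updates v s then 1 else 0))"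
    unfolding HB_eq sum_distrib_left[symmetric] by (subst sum.swap) rule
  also have "(\<Sum>v\<in>V - {w}. \<Sum>t\<in>\<Lambda>. \<mu> t / local_weight v s * (if t \<in> updates v s then 1 else 0))
      = (\<Sum>v\<in>V - {w}. 1)"
  proof (rule sum.cong[OF refl])
    fix v assume v: "v \<in> V - {w}"
    show "(\<Sum>t\<in>\<Lambda>. \<mu> t / local_weight v s * (if t \<in> updates v s then 1 else 0)) = 1"
      using local_weight_pos[of v s]
      by (simp add: sum_updates[OF s v] local_weight_def flip: sum_divide_distrib)
  qed
  also have "1 / (real (card V) - 1) * (\<Sum>v\<in>V - {w}. 1) = 1"
    using card_V_minus card_V_gt_1 by simp
  finally show "(\<Sum>t\<in>\<Lambda>. HB s t) = 1" .
qed (auto simp: mu_pos)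

text \<open>For each \<open>v\<close> the state \<open>t\<close> has \<open>q\<close> predecessors,
  all moving to \<open>t\<close> with the same probability, which is at most 1.\<close>

lemma HB_column_sum_le:
  assumes t: "t \<in> \<Lambda>"
  shows "(\<Sum>s\<in>\<Lambda>. HB s t) \<le> real q"
proof -
  have "(\<Sum>s\<in>\<Lambda>. HB s t) = 1 / (real (card V) - 1) *
     (\<Sum>v\<in>V - {w}. \<Sum>s\<in>\<Lambda>. \<mu> t / local_weight v s * (if t \<in> updates v s then 1 else 0))"
    unfolding HB_eq sum_distrib_left[symmetric] by (subst sum.swap) rule
  also have "\<dots> \<le> 1 / (real (card V) - 1) * (\<Sum>v\<in>V - {w}. real q)"
  proof (intro mult_left_mono sum_mono)
    fix v assume v: "v \<in> V - {w}"
    have "(\<Sum>s\<in>\<Lambda>. \<mu> t / local_weight v s * (if t \<in> updates v s then 1 else 0))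
        = (\<Sum>s\<in>\<Lambda>. \<mu> t / local_weight v t * (if s \<in> updates v t then 1 else 0))"
      using updates_sym_iff[OF _ t v] by (intro sum.cong refl) (auto simp: local_weight_updates)
    also have "\<dots> = real q * (\<mu> t / local_weight v t)"
      by (simp only: sum_updates[OF t v]) simp
    also have "\<dots> \<le> real q * 1"
    proof (rule mult_left_mono)
      have "\<mu> (t(v := t v)) \<le> local_weight v t"
        unfolding local_weight_def using fixed_state_range[OF t v]
        by (intro member_le_sum) (auto simp: mu_pos less_imp_le)
      thus "\<mu> t / local_weight v t \<le> 1" using local_weight_pos[of v t] by simp
    qed simp
    finally show "(\<Sum>s\<in>\<Lambda>. \<mu> t / local_weight v s * (if t \<in> updates v s then 1 else 0)) \<le> real q"
      by simp
  qed (use card_V_gt_1 in auto)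
  also have "\<dots> = real q" using card_V_minus card_V_gt_1 by simp
  finally show ?thesis .
qed

text \<open>Irreducibility in functional form: the states \<open>override_on s t F\<close> lead from
  \<open>s\<close> to \<open>t\<close> one vertex at a time, and each change has positive
  probability under the heat bath.\<close>

lemma HB_fixed_points_constant:
  assumes f: "\<And>s. s \<in> \<Lambda> \<Longrightarrow> HB.op f s = f s" and st: "s \<in> \<Lambda>" "t \<in> \<Lambda>"
  shows "f s = f t"
proof -
  have "override_on s t F \<in> \<Lambda> \<and> f (override_on s t F) = f s" if "finite F" "F \<subseteq> V - {w}" for F
    using that
  proof (induction F rule: finite_induct)
    case (insert v F)
    define u where "u = override_on s t F"
    have u: "u \<in> \<Lambda>" "f u = f s" using insert by (auto simp: u_def)
    have v: "v \<in> V - {w}" using insert by simp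
    have eq: "override_on s t (insert v F) = u(v := t v)"
      unfolding u_def by (auto simp: override_on_def)
    have up: "u(v := t v) \<in> updates v u"
      using fixed_state_range[OF st(2) v] unfolding updates_def by blast
    have "u(v := t v) \<in> \<Lambda>" using updates_subset[OF u(1) v] up by blast
    moreover from this have "f u = f (u(v := t v))"
      using HB.fixed_point_neighbours[OF f u(1)] HB_pos[OF v up] by blast
    ultimately have "u(v := t v) \<in> \<Lambda> \<and> f (u(v := t v)) = f s" using u(2) by simp
    thus ?case by (simp only: eq)
  qed (use st in simp)
  from this[of "V - {w}"] have "f (override_on s t (V - {w})) = f s" by simp
  moreover have "override_on s t (V - {w}) = t"
  proof
    fix x show "override_on s t (V - {w}) x = t x"
      using st PiE_arb[of s "V - {w}" "\<lambda>_. {1..q}" x] PiE_arb[of t "V - {w}" "\<lambda>_. {1..q}" x]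
      by (auto simp: override_on_def fixed_states_def)
  qed
  ultimately show ?thesis by simp
qed

text \<open>The gap says nothing about the eigenvalue 1, so it must be excluded first: a fixed point
  is constant, and a constant of mean zero vanishes.\<close>

lemma HB_mean_zero_eigenvalue_le:
  assumes f: "\<And>s. s \<in> \<Lambda> \<Longrightarrow> HB.op f s = \<eta> * f s" "HB.ip f (\<lambda>_. 1) = 0" "\<exists>s\<in>\<Lambda>. f s \<noteq> 0"
  shows "\<bar>\<eta>\<bar> \<le> 1 - spectral_gap \<Lambda> HB"
proof -
  obtain s where s: "s \<in> \<Lambda>" "f s \<noteq> 0" using f(3) by blast
  have "\<eta> \<noteq> 1"
  proof
    assume "\<eta> = 1"
    hence const: "f t = f s" if "t \<in> \<Lambda>" for t
      using HB_fixed_points_constant[of f t s] f(1) s that by simp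
    have "HB.ip f (\<lambda>_. 1) = (\<Sum>t\<in>\<Lambda>. \<mu> t) * f s"
      unfolding weighted_inner_def sum_distrib_right by (intro sum.cong) (auto dest: const)
    moreover have "(\<Sum>t\<in>\<Lambda>. \<mu> t) > 0" using s by (intro sum_pos mu_pos) auto
    ultimately show False using f(2) s by simp
  qed
  hence "cmod (of_real \<eta>) \<le> 1 - spectral_gap \<Lambda> HB"
    using HB.is_eigenvalueI[OF f(1) s] by (intro cmod_eigenvalue_le) auto
  thus ?thesis by simp
qed

sublocale two_reversible_kernels \<Lambda> \<mu> HB SW_fixed ..

lemma sandwich_le:
  assumes st: "s \<in> \<Lambda>" "t \<in> \<Lambda>"
  shows "sandwich s t \<le> real q * C\<^sup>2 * SW_fixed s t"
proof -
  have "sandwich s t \<le> (\<Sum>s'\<in>\<Lambda>. \<Sum>t'\<in>\<Lambda>. HB s s' * (C\<^sup>2 * SW_fixed s t) * HB t' t)"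
    unfolding sandwich_def
  proof (intro sum_mono)
    fix s' t' assume st': "s' \<in> \<Lambda>" "t' \<in> \<Lambda>"
    show "HB s s' * SW_fixed s' t' * HB t' t \<le> HB s s' * (C\<^sup>2 * SW_fixed s t) * HB t' t"
    \<comment> \<open>Nonzero weights mean that \<open>s'\<close> arises from \<open>s\<close>, and
      \<open>t\<close> from \<open>t'\<close>, by one recolouring; each replacement costs one factor
      \<open>C\<close>.\<close>
    proof (cases "HB s s' = 0 \<or> HB t' t = 0")
      case False
      then obtain v l v' l' where "v \<in> V - {w}" "s' = s(v := l)" "v' \<in> V - {w}" "t = t'(v' := l')"
        using HB_posD by metis
      hence "SW_fixed s' t' \<le> C * SW_fixed s t'" "SW_fixed s t' \<le> C * SW_fixed s t"
        using SW_fixed_update_left SW_fixed_update_right by auto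
      hence "SW_fixed s' t' \<le> C * (C * SW_fixed s t)"
        using C_pos by (meson less_imp_le mult_left_mono order_trans)
      thus ?thesis using st st' HB.kernel_nonneg
        by (intro mult_right_mono mult_left_mono) (auto simp: power2_eq_square)
    qed auto
  qed
  also have "\<dots> = (\<Sum>s'\<in>\<Lambda>. HB s s') * (C\<^sup>2 * SW_fixed s t) * (\<Sum>t'\<in>\<Lambda>. HB t' t)"
    by (simp add: sum_product sum_distrib_left sum_distrib_right mult_ac)
  also have "\<dots> \<le> 1 * (C\<^sup>2 * SW_fixed s t) * real q"
    using st HB_column_sum_le SW.kernel_nonneg
    by (simp add: HB.kernel_sum mult_left_mono)
  finally show ?thesis by (simp add: mult_ac)
qed

lemma SW_fixed_eigenvalue_le:
  assumes "\<And>s. s \<in> \<Lambda> \<Longrightarrow> SW.op g s = \<xi> * g s" "\<xi> \<noteq> 1" "\<exists>s\<in>\<Lambda>. g s \<noteq> 0"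
  shows "1 - \<xi> \<ge> spectral_gap \<Lambda> HB / (real q * C\<^sup>2)"
proof -
  have "1 - \<xi> \<ge> (1 - (1 - spectral_gap \<Lambda> HB)) / (real q * C\<^sup>2)"
    using q_ge_1 C_pos
    by (intro eigenvalue_comparison[OF sandwich_le _ assms HB_mean_zero_eigenvalue_le])
       (auto simp: spectral_gap_le_one)
  thus ?thesis by simp
qed

section \<open>Eigenvalues of Swendsen--Wang\<close>

lemma SW_eigenvalue_reduce:
  assumes "is_eigenvalue \<Omega> (P_SW V E endpts q \<beta>) \<xi>" "\<xi> \<noteq> 0"
  shows "is_eigenvalue \<Lambda> SW_fixed \<xi>"
proof -
  obtain f \<sigma> where \<sigma>: "\<sigma> \<in> \<Omega>" "f \<sigma> \<noteq> 0"
    and f: "\<And>\<sigma>. \<sigma> \<in> \<Omega> \<Longrightarrow> (\<Sum>\<tau>\<in>\<Omega>. complex_of_real (P_SW V E endpts q \<beta> \<sigma> \<tau>) * f \<tau>) = \<xi> * f \<sigma>"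
    using assms(1) unfolding is_eigenvalue_def by blast
  \<comment> \<open>Solving the eigenvalue equation for \<open>f\<close> exhibits it as a function
    of the monochromatic edges; the division is where \<open>\<xi> \<noteq> 0\<close>
    enters.\<close>
  define F where "F B = (\<Sum>\<tau>\<in>\<Omega>. complex_of_real (exp (- \<beta> * card B) * fk_sum (B \<inter> mono_at \<tau>)) * f \<tau>) / \<xi>" for B
  have F: "f \<tau> = F (mono_at \<tau>)" if "\<tau> \<in> \<Omega>" for \<tau>
    using f[OF that] assms(2) by (simp add: F_def P_SW_eq)
  have "(\<Sum>t\<in>\<Lambda>. complex_of_real (SW_fixed s t) * F (mono_fixed t)) = \<xi> * F (mono_fixed s)" for s
  proof -
    let ?h = "\<lambda>B. complex_of_real (exp (- \<beta> * card (mono_fixed s)) * fk_sum (mono_fixed s \<inter> B)) * F B"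
    have "\<xi> * F (mono_fixed s) = (\<Sum>\<tau>\<in>\<Omega>. complex_of_real (exp (- \<beta> * card (mono_fixed s))
        * fk_sum (mono_fixed s \<inter> mono_at \<tau>)) * f \<tau>)"
      using assms(2) by (simp add: F_def)
    also have "\<dots> = (\<Sum>\<tau>\<in>\<Omega>. ?h (mono_at \<tau>))"
      by (intro sum.cong refl) (simp add: F)
    also have "\<dots> = of_nat q * (\<Sum>t\<in>\<Lambda>. ?h (mono_fixed t))" by (rule sum_mono_invariant(1))
    also have "\<dots> = (\<Sum>t\<in>\<Lambda>. complex_of_real (SW_fixed s t) * F (mono_fixed t))"
      by (simp add: SW_fixed_eq sum_distrib_left mult_ac)
    finally show ?thesis by simp
  qed
  moreover obtain t where "t \<in> \<Lambda>" "mono_fixed t = mono_at \<sigma>"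
    using sum_mono_invariant(2)[OF \<sigma>(1)] by blast
  ultimately show ?thesis
    unfolding is_eigenvalue_def using \<sigma> F by (intro exI[of _ "\<lambda>t. F (mono_fixed t)"]) (auto intro!: bexI[of _ t])
qed

text \<open>The indicator of \<open>A \<subseteq> B \<inter> B'\<close> splits into a product, which
  later turns the quadratic form into a weighted sum of squares.\<close>

lemma fk_sum_Int_eq:
  "fk_sum (B \<inter> B') = (\<Sum>A\<in>Pow E. fk_weight A * (of_bool (A \<subseteq> B) * of_bool (A \<subseteq> B')))"
  if "B \<subseteq> E"
proof -
  have "fk_sum (B \<inter> B') = (\<Sum>A\<in>Pow (B \<inter> B'). fk_weight A * (of_bool (A \<subseteq> B) * of_bool (A \<subseteq> B')))"
    unfolding fk_sum_def by (intro sum.cong) auto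
  also have "\<dots> = (\<Sum>A\<in>Pow E. fk_weight A * (of_bool (A \<subseteq> B) * of_bool (A \<subseteq> B')))"
    using that by (intro sum.mono_neutral_left) auto
  finally show ?thesis .
qed

text \<open>Swendsen--Wang factors through the random-cluster model, hence is positive semidefinite.\<close>

lemma SW_fixed_eigenvalue_nonneg:
  assumes g: "\<And>s. s \<in> \<Lambda> \<Longrightarrow> (\<Sum>t\<in>\<Lambda>. complex_of_real (SW_fixed s t) * g t) = \<xi> * g s"
    and "\<exists>s\<in>\<Lambda>. g s \<noteq> 0"
  obtains x where "\<xi> = complex_of_real x" "x \<ge> 0"
proof -
  \<comment> \<open>Up to a constant, \<open>N\<close> is the squared norm of \<open>g\<close> under
    \<mu>. Testing the eigenvalue equation against \<open>cnj g\<close> gives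
    \<open>\<xi> * N = R\<close>, so \<open>\<xi>\<close> is at once real and nonnegative.\<close>
  define N where "N = (\<Sum>s\<in>\<Lambda>. exp (\<beta> * card (mono_fixed s)) * (cmod (g s))\<^sup>2)"
  define G where "G A = (\<Sum>s\<in>\<Lambda>. of_bool (A \<subseteq> mono_fixed s) * g s)" for A
  define R where "R = real q * (\<Sum>A\<in>Pow E. fk_weight A * (cmod (G A))\<^sup>2)"
  obtain s\<^sub>0 where s\<^sub>0: "s\<^sub>0 \<in> \<Lambda>" "g s\<^sub>0 \<noteq> 0" using assms(2) by blast
  have "N > 0" unfolding N_def
    by (rule sum_pos2[OF _ s\<^sub>0(1)]) (use s\<^sub>0 in auto)
  have "\<xi> * of_real N = (\<Sum>s\<in>\<Lambda>. of_real (exp (\<beta> * card (mono_fixed s))) * cnj (g s) * (\<xi> * g s))"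
    unfolding N_def of_real_sum sum_distrib_left
    by (intro sum.cong refl) (simp only: of_real_mult complex_norm_square of_real_of_nat_eq mult_ac)
  also have "\<dots> = (\<Sum>s\<in>\<Lambda>. of_real (exp (\<beta> * card (mono_fixed s))) * cnj (g s) *
      (\<Sum>t\<in>\<Lambda>. complex_of_real (SW_fixed s t) * g t))"
    by (intro sum.cong refl) (simp add: g)
  also have "\<dots> = (\<Sum>s\<in>\<Lambda>. \<Sum>t\<in>\<Lambda>. \<Sum>A\<in>Pow E. of_nat q * (of_real (fk_weight A)
      * ((of_bool (A \<subseteq> mono_fixed s) * cnj (g s)) * (of_bool (A \<subseteq> mono_fixed t) * g t))))"
    (is "_ = (\<Sum>s\<in>\<Lambda>. \<Sum>t\<in>\<Lambda>. \<Sum>A\<in>Pow E. ?h s t A)")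
  proof (subst sum_distrib_left, intro sum.cong refl)
    fix s t
    have of_bool: "complex_of_real (of_bool b) = of_bool b" for b by (cases b) auto
    have e: "exp (\<beta> * card (mono_fixed s)) * exp (- \<beta> * card (mono_fixed s)) = 1"
      by (simp add: mult_exp_exp)
    have "of_real (exp (\<beta> * card (mono_fixed s))) * cnj (g s) * (complex_of_real (SW_fixed s t) * g t)
        = of_real ((exp (\<beta> * card (mono_fixed s)) * exp (- \<beta> * card (mono_fixed s)))
            * (real q * fk_sum (mono_fixed s \<inter> mono_fixed t))) * (cnj (g s) * g t)"
      unfolding SW_fixed_eq of_real_mult by (simp only: mult_ac)
    also have "\<dots> = (\<Sum>A\<in>Pow E. ?h s t A)"
      unfolding e fk_sum_Int_eq[OF mono_subset]
      by (simp add: sum_distrib_left sum_distrib_right of_bool mult_ac)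
    finally show "of_real (exp (\<beta> * card (mono_fixed s))) * cnj (g s) * (complex_of_real (SW_fixed s t) * g t)
        = (\<Sum>A\<in>Pow E. ?h s t A)" .
  qed
  also have "\<dots> = (\<Sum>s\<in>\<Lambda>. \<Sum>A\<in>Pow E. \<Sum>t\<in>\<Lambda>. ?h s t A)"
    by (intro sum.cong refl sum.swap)
  also have "\<dots> = (\<Sum>A\<in>Pow E. \<Sum>s\<in>\<Lambda>. \<Sum>t\<in>\<Lambda>. ?h s t A)"
    by (rule sum.swap)
  also have "\<dots> = (\<Sum>A\<in>Pow E. of_nat q * (of_real (fk_weight A) * (cnj (G A) * G A)))"
  proof (intro sum.cong refl)
    fix A
    have cnj_G: "cnj (G A) = (\<Sum>s\<in>\<Lambda>. of_bool (A \<subseteq> mono_fixed s) * cnj (g s))"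
      unfolding G_def cnj_sum by (intro sum.cong refl) auto
    show "(\<Sum>s\<in>\<Lambda>. \<Sum>t\<in>\<Lambda>. ?h s t A) = of_nat q * (of_real (fk_weight A) * (cnj (G A) * G A))"
      unfolding cnj_G unfolding G_def sum_product by (simp only: sum_distrib_left)
  qed
  also have "\<dots> = of_real R"
    unfolding R_def of_real_mult of_real_sum sum_distrib_left
    by (intro sum.cong refl) (simp only: of_real_mult complex_norm_square of_real_of_nat_eq mult_ac)
  finally have "\<xi> = of_real (R / N)"
    using \<open>N > 0\<close> by (simp add: field_simps)
  moreover have "R / N \<ge> 0"
    unfolding R_def using \<open>N > 0\<close> by (intro divide_nonneg_pos mult_nonneg_nonneg sum_nonneg fk_weight_nonneg) auto
  ultimately show thesis by (rule that)
qed

text \<open>The comparison works with real functions. As \<open>\<xi>\<close> is real, the real and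
  imaginary parts of an eigenfunction satisfy the same equation, and one of them is nonzero.\<close>

lemma SW_fixed_cmod_eigenvalue_le:
  assumes "is_eigenvalue \<Lambda> SW_fixed \<xi>" "\<xi> \<noteq> 1"
  shows "cmod \<xi> \<le> 1 - spectral_gap \<Lambda> HB / (real q * C\<^sup>2)"
proof -
  obtain g s where s: "s \<in> \<Lambda>" "g s \<noteq> 0"
    and g: "\<And>s. s \<in> \<Lambda> \<Longrightarrow> (\<Sum>t\<in>\<Lambda>. complex_of_real (SW_fixed s t) * g t) = \<xi> * g s"
    using assms(1) unfolding is_eigenvalue_def by blast
  obtain x where x: "\<xi> = complex_of_real x" "x \<ge> 0"
    using SW_fixed_eigenvalue_nonneg[OF g] s by blast
  have eig: "SW.op (\<lambda>t. Re (g t)) s = x * Re (g s)" "SW.op (\<lambda>t. Im (g t)) s = x * Im (g s)"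
    if "s \<in> \<Lambda>" for s
    using arg_cong[OF g[OF that], of Re] arg_cong[OF g[OF that], of Im]
    by (simp_all add: apply_kernel_def x)
  have "x \<noteq> 1" using assms(2) x by auto
  have "1 - x \<ge> spectral_gap \<Lambda> HB / (real q * C\<^sup>2)"
  proof (cases "Re (g s) = 0")
    case False
    thus ?thesis using s \<open>x \<noteq> 1\<close> by (intro SW_fixed_eigenvalue_le[OF eig(1)]) auto
  next
    case True
    hence "Im (g s) \<noteq> 0" using s(2) by (simp add: complex_eq_iff)
    thus ?thesis using s \<open>x \<noteq> 1\<close> by (intro SW_fixed_eigenvalue_le[OF eig(2)]) auto
  qed
  thus ?thesis using x by simp
qed

lemma spectral_gap_comparison:
  "spectral_gap \<Lambda> HB / (real q * C\<^sup>2) \<le> spectral_gap \<Omega> (P_SW V E endpts q \<beta>)"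
proof (rule spectral_gap_geI)
  have "1 * 1 \<le> real q * exp (2 * \<beta>)"
    using q_ge_1 beta_nonneg by (intro mult_mono) auto
  hence "C \<ge> 1" by (simp add: C_def one_le_power)
  hence "1 * 1 \<le> real q * C\<^sup>2"
    using q_ge_1 by (intro mult_mono) (auto simp: one_le_power)
  moreover have "spectral_gap \<Lambda> HB \<le> 1" by (simp add: spectral_gap_le_one)
  ultimately show le1: "spectral_gap \<Lambda> HB / (real q * C\<^sup>2) \<le> 1"
    by (simp add: divide_le_eq)
  fix \<xi> assume "is_eigenvalue \<Omega> (P_SW V E endpts q \<beta>) \<xi>" "\<xi> \<noteq> 1"
  \<comment> \<open>The reduction to the fixed-vertex states covers nonzero eigenvalues; for
    \<open>\<xi> = 0\<close> the claim is \<open>le1\<close>.\<close>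
  thus "cmod \<xi> \<le> 1 - spectral_gap \<Lambda> HB / (real q * C\<^sup>2)"
    using le1 SW_eigenvalue_reduce SW_fixed_cmod_eigenvalue_le by (cases "\<xi> = 0") auto
qed simp

end

theorem theorem3p9:
  fixes V :: "'v set" and E :: "'e set" and endpts :: "'e \<Rightarrow> 'v \<times> 'v"
    and q :: nat and \<beta> :: real and w :: 'v
  assumes "finite V" and "finite E"
    and "\<And>e. e \<in> E \<Longrightarrow> fst (endpts e) \<in> V \<and> snd (endpts e) \<in> V"
    and "q \<ge> 1" and "\<beta> \<ge> 0"
    and "w \<in> V" and "card V \<ge> 2"
  shows "spectral_gap (potts_states V q) (P_SW V E endpts q \<beta>)
      \<ge> (1 / real q) * inverse ((real q * exp (2 * \<beta>)) ^ (2 * Max (deg E endpts ` (V - {w}))))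
        * spectral_gap (fixed_states V w q) (P_HB_w V E endpts q \<beta> w)"
proof -
  interpret potts_model V E endpts q \<beta> w
    by unfold_locales (use assms in auto)
  have "C\<^sup>2 = (real q * exp (2 * \<beta>)) ^ (2 * Max (deg E endpts ` (V - {w})))"
    by (simp add: C_def \<Delta>_def power_mult power_mult_distrib mult.commute flip: power_mult)
  thus ?thesis using spectral_gap_comparison by (simp add: field_simps)
qed

end
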